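(* Let $(X,\omega)$ and $(Y,\sigma)$ be Kähler manifolds with $\dim_{\mathbb{C}}X=n$ and $\dim_{\mathbb{C}}Y=N$, where $2\le n\le N\le 2n-1$, and let $f:(X,\omega)\to(Y,\sigma)$ be a holomorphic conformal embedding. Suppose that the curvature tensors of $(X,\omega)$ and of $(Y,\sigma)$ are pseudo-conformally flat. Then $f(X)$ is a totally geodesic submanifold of $Y$.
   Context: A holomorphic map $f:(X,\omega)\to(Y,\sigma)$ between Hermitian manifolds is called conformal if $f^*\sigma=k\,\omega$ holds on $X$ for some positive constant $k$. A tensor $T_{\alpha\overline\beta\mu\overline\nu}$ on a complex manifold equipped with a Hermitian metric is called pseudo-conformally flat if in any holomorphic chart $$T_{\alpha\overline\beta\mu\overline\nu}=H_{\alpha\overline\beta}\,g_{\mu\overline\nu}+\hat H_{\mu\overline\beta}\,g_{\alpha\overline\nu}+H^*_{\alpha\overline\nu}\,g_{\mu\overline\beta}+\widetilde H_{\mu\overline\nu}\,g_{\alpha\overline\beta},$$ where $(H_{\alpha\overline\beta})$, $(\hat H_{\alpha\overline\beta})$, $(H^*_{\alpha\overline\beta})$, $(\widetilde H_{\alpha\overline\beta})$ are smoothly varying Hermitian matrices over the chart and $(g_{\alpha\overline\beta})$ is the matrix of the Hermitian metric over the chart. For the curvature tensor $R_{\alpha\overline\beta\mu\overline\nu}$ of a Kähler manifold, $g$ is the given Kähler metric ($\omega$ on $X$, $\sigma$ on $Y$). Totally geodesic is meant with respect to the metric $\sigma$ on $Y$. *)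

theory Defs
  imports "HOL-Analysis.Analysis"
begin

section \<open>Smooth and holomorphic maps on open sets\<close>

primrec Ck_on :: "nat \<Rightarrow> 'a::real_normed_vector set \<Rightarrow> ('a \<Rightarrow> 'b::real_normed_vector) \<Rightarrow> bool" where
  "Ck_on 0 S f \<longleftrightarrow> continuous_on S f"
| "Ck_on (Suc k) S f \<longleftrightarrow>
     (\<forall>x\<in>S. f differentiable (at x)) \<and> (\<forall>v. Ck_on k S (\<lambda>x. frechet_derivative f (at x) v))"

text \<open>Smoothness is in the real sense; these notions are only used for open \<open>S\<close> in
  finite-dimensional spaces, where it suffices to iterate directional derivatives.\<close>

definition smooth_on :: "'a::real_normed_vector set \<Rightarrow> ('a \<Rightarrow> 'b::real_normed_vector) \<Rightarrow> bool" where
  "smooth_on S f \<longleftrightarrow> (\<forall>k. Ck_on k S f)"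

text \<open>Complex linearity of the differential is the Cauchy--Riemann system.\<close>

definition holo_on :: "(complex^'n::finite) set \<Rightarrow> (complex^'n \<Rightarrow> complex^'m::finite) \<Rightarrow> bool" where
  "holo_on S f \<longleftrightarrow> smooth_on S f \<and>
     (\<forall>z\<in>S. \<forall>c v. frechet_derivative f (at z) (c *s v) = c *s frechet_derivative f (at z) v)"

text \<open>The Wirtinger operators \<open>\<partial>/\<partial>z\<^sup>i\<close> and their conjugates.\<close>

definition d_z :: "'n::finite \<Rightarrow> (complex^'n \<Rightarrow> complex) \<Rightarrow> complex^'n \<Rightarrow> complex" where
  "d_z i f z = (frechet_derivative f (at z) (axis i 1)
                - \<i> * frechet_derivative f (at z) (axis i \<i>)) / 2"

definition d_zbar :: "'n::finite \<Rightarrow> (complex^'n \<Rightarrow> complex) \<Rightarrow> complex^'n \<Rightarrow> complex" where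
  "d_zbar i f z = (frechet_derivative f (at z) (axis i 1)
                + \<i> * frechet_derivative f (at z) (axis i \<i>)) / 2"


section \<open>Complex manifolds\<close>

text \<open>A chart is a pair \<open>(U, \<phi>)\<close>; only the values of \<open>\<phi>\<close> on \<open>U\<close> matter.
  The complex dimension is \<open>CARD('n)\<close>.\<close>

type_synonym ('a, 'n) chart = "'a set \<times> ('a \<Rightarrow> complex^'n)"

abbreviation chart_dom :: "('a, 'n::finite) chart \<Rightarrow> 'a set" where
  "chart_dom c \<equiv> fst c"

abbreviation chart_map :: "('a, 'n::finite) chart \<Rightarrow> 'a \<Rightarrow> complex^'n" where
  "chart_map c \<equiv> snd c"

definition chart_img :: "('a, 'n::finite) chart \<Rightarrow> (complex^'n) set" where
  "chart_img c = chart_map c ` chart_dom c"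

definition chart_inv :: "('a, 'n::finite) chart \<Rightarrow> complex^'n \<Rightarrow> 'a" where
  "chart_inv c = inv_into (chart_dom c) (chart_map c)"

definition is_chart :: "'a topology \<Rightarrow> ('a, 'n::finite) chart \<Rightarrow> bool" where
  "is_chart T c \<longleftrightarrow> openin T (chart_dom c) \<and> open (chart_img c) \<and>
     homeomorphic_map (subtopology T (chart_dom c)) (top_of_set (chart_img c)) (chart_map c)"

text \<open>Applied to all ordered pairs, so that transition maps are biholomorphic.\<close>

definition holo_transition :: "('a, 'n::finite) chart \<Rightarrow> ('a, 'n) chart \<Rightarrow> bool" where
  "holo_transition c d \<longleftrightarrow>
     holo_on (chart_map c ` (chart_dom c \<inter> chart_dom d)) (chart_map d \<circ> chart_inv c)"

definition complex_atlas :: "'a topology \<Rightarrow> ('a, 'n::finite) chart set \<Rightarrow> bool" where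
  "complex_atlas T A \<longleftrightarrow> (\<forall>c\<in>A. is_chart T c) \<and> (\<Union>c\<in>A. chart_dom c) = topspace T \<and>
     (\<forall>c\<in>A. \<forall>d\<in>A. holo_transition c d)"

text \<open>The component \<open>metric M c z\<close> is the matrix \<open>(g\<^sub>\<alpha>\<^sub>\<beta>)\<close> (second index barred) of the Hermitian
  metric in the chart \<open>c\<close> at the point with coordinates \<open>z\<close>.\<close>

record ('a, 'n) hermitian_structure =
  space_top :: "'a topology"
  atlas :: "('a, 'n) chart set"
  metric :: "('a, 'n) chart \<Rightarrow> complex^'n \<Rightarrow> complex^'n^'n"

text \<open>The maximal atlas.\<close>

definition holo_charts :: "('a, 'n::finite) hermitian_structure \<Rightarrow> ('a, 'n) chart set" where
  "holo_charts M = {c. is_chart (space_top M) c \<and>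
     (\<forall>d\<in>atlas M. holo_transition c d \<and> holo_transition d c)}"

definition complex_manifold :: "('a, 'n::finite) hermitian_structure \<Rightarrow> bool" where
  "complex_manifold M \<longleftrightarrow> Hausdorff_space (space_top M) \<and> second_countable (space_top M) \<and>
     complex_atlas (space_top M) (atlas M)"


section \<open>Hermitian and Kaehler metrics\<close>

definition hermitian_matrix :: "complex^'n^'n::finite \<Rightarrow> bool" where
  "hermitian_matrix G \<longleftrightarrow> (\<forall>a b. G $ a $ b = cnj (G $ b $ a))"

definition herm_form :: "complex^'n^'n::finite \<Rightarrow> complex^'n \<Rightarrow> complex^'n \<Rightarrow> complex" where
  "herm_form G u v = (\<Sum>a\<in>UNIV. \<Sum>b\<in>UNIV. G $ a $ b * u $ a * cnj (v $ b))"

definition positive_matrix :: "complex^'n^'n::finite \<Rightarrow> bool" where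
  "positive_matrix G \<longleftrightarrow> (\<forall>v. v \<noteq> 0 \<longrightarrow> Re (herm_form G v v) > 0)"

definition hermitian_manifold :: "('a, 'n::finite) hermitian_structure \<Rightarrow> bool" where
  "hermitian_manifold M \<longleftrightarrow> complex_manifold M \<and>
     (\<forall>c\<in>holo_charts M. smooth_on (chart_img c) (metric M c) \<and>
        (\<forall>z\<in>chart_img c. hermitian_matrix (metric M c z) \<and> positive_matrix (metric M c z))) \<and>
     (\<forall>c\<in>holo_charts M. \<forall>d\<in>holo_charts M. \<forall>p\<in>chart_dom c \<inter> chart_dom d. \<forall>u v.
        let J = frechet_derivative (chart_map d \<circ> chart_inv c) (at (chart_map c p))
        in herm_form (metric M c (chart_map c p)) u v
           = herm_form (metric M d (chart_map d p)) (J u) (J v))"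

text \<open>The fundamental form \<open>(\<i>/2) \<Sum> g\<^sub>\<alpha>\<^sub>\<beta> dz\<^sup>\<alpha> \<and> d\<bar>z\<^sup>\<beta>\<close>, as a real 2-form, evaluated on
  real tangent vectors, which in a chart are elements of \<open>complex^'n\<close>.\<close>

definition kaehler_form :: "complex^'n^'n::finite \<Rightarrow> complex^'n \<Rightarrow> complex^'n \<Rightarrow> real" where
  "kaehler_form G u v = - Im (herm_form G u v)"

text \<open>Closedness: the exterior derivative evaluated on constant vector fields of a chart.\<close>

definition kaehler_manifold :: "('a, 'n::finite) hermitian_structure \<Rightarrow> bool" where
  "kaehler_manifold M \<longleftrightarrow> hermitian_manifold M \<and>
     (\<forall>c\<in>holo_charts M. \<forall>z\<in>chart_img c. \<forall>u v w.
        frechet_derivative (\<lambda>x. kaehler_form (metric M c x) v w) (at z) u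
        - frechet_derivative (\<lambda>x. kaehler_form (metric M c x) u w) (at z) v
        + frechet_derivative (\<lambda>x. kaehler_form (metric M c x) u v) (at z) w = 0)"


section \<open>Curvature\<close>

text \<open>\<open>g_inv G a b\<close> is \<open>g\<^sup>a\<^sup>b\<close> (second index barred), normalised by
  \<open>\<Sum>\<^sub>b g\<^sup>a\<^sup>b g\<^sub>c\<^sub>b = \<delta>\<^sub>a\<^sub>c\<close>; hence the transposition.\<close>

definition g_inv :: "complex^'n^'n::finite \<Rightarrow> 'n \<Rightarrow> 'n \<Rightarrow> complex" where
  "g_inv G a b = matrix_inv G $ b $ a"

text \<open>\<open>R\<^sub>\<alpha>\<^sub>\<beta>\<^sub>\<mu>\<^sub>\<nu> = - \<partial>\<^sub>\<mu> \<partial>\<^sub>\<nu> g\<^sub>\<alpha>\<^sub>\<beta> + \<Sum> g\<^sup>s\<^sup>t (\<partial>\<^sub>\<mu> g\<^sub>\<alpha>\<^sub>t) (\<partial>\<^sub>\<nu> g\<^sub>s\<^sub>\<beta>)\<close> with \<open>\<beta>, \<nu>, t\<close> barred.\<close>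

definition curvature ::
  "('a, 'n::finite) hermitian_structure \<Rightarrow> ('a, 'n) chart \<Rightarrow> complex^'n \<Rightarrow> 'n \<Rightarrow> 'n \<Rightarrow> 'n \<Rightarrow> 'n \<Rightarrow> complex" where
  "curvature M c z a b m n = (let g = (\<lambda>i j x. metric M c x $ i $ j) in
     - d_z m (d_zbar n (g a b)) z
     + (\<Sum>s\<in>UNIV. \<Sum>t\<in>UNIV. g_inv (metric M c z) s t * d_z m (g a t) z * d_zbar n (g s b) z))"

definition pseudo_conformally_flat ::
  "('a, 'n::finite) hermitian_structure \<Rightarrow>
   (('a, 'n) chart \<Rightarrow> complex^'n \<Rightarrow> 'n \<Rightarrow> 'n \<Rightarrow> 'n \<Rightarrow> 'n \<Rightarrow> complex) \<Rightarrow> bool" where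
  "pseudo_conformally_flat M T \<longleftrightarrow> (\<forall>c\<in>holo_charts M.
     \<exists>H1 H2 H3 H4 :: complex^'n \<Rightarrow> complex^'n^'n.
       (\<forall>H\<in>{H1, H2, H3, H4}. smooth_on (chart_img c) H \<and>
          (\<forall>z\<in>chart_img c. hermitian_matrix (H z))) \<and>
       (\<forall>z\<in>chart_img c. \<forall>a b m n. let g = metric M c z in
          T c z a b m n = H1 z $ a $ b * g $ m $ n + H2 z $ m $ b * g $ a $ n
                        + H3 z $ a $ n * g $ m $ b + H4 z $ m $ n * g $ a $ b))"


section \<open>Holomorphic conformal embeddings\<close>

definition local_rep ::
  "('a, 'n::finite) chart \<Rightarrow> ('b, 'm::finite) chart \<Rightarrow> ('a \<Rightarrow> 'b) \<Rightarrow> complex^'n \<Rightarrow> complex^'m" where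
  "local_rep c d f = chart_map d \<circ> f \<circ> chart_inv c"

definition holomorphic_map ::
  "('a, 'n::finite) hermitian_structure \<Rightarrow> ('b, 'm::finite) hermitian_structure \<Rightarrow> ('a \<Rightarrow> 'b) \<Rightarrow> bool" where
  "holomorphic_map X Y f \<longleftrightarrow> continuous_map (space_top X) (space_top Y) f \<and>
     (\<forall>c\<in>holo_charts X. \<forall>d\<in>holo_charts Y.
        holo_on (chart_map c ` (chart_dom c \<inter> f -` chart_dom d)) (local_rep c d f))"

definition holomorphic_embedding ::
  "('a, 'n::finite) hermitian_structure \<Rightarrow> ('b, 'm::finite) hermitian_structure \<Rightarrow> ('a \<Rightarrow> 'b) \<Rightarrow> bool" where
  "holomorphic_embedding X Y f \<longleftrightarrow> holomorphic_map X Y f \<and>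
     embedding_map (space_top X) (space_top Y) f \<and>
     (\<forall>c\<in>holo_charts X. \<forall>d\<in>holo_charts Y. \<forall>p\<in>chart_dom c \<inter> f -` chart_dom d.
        inj (frechet_derivative (local_rep c d f) (at (chart_map c p))))"

definition conformal_map ::
  "('a, 'n::finite) hermitian_structure \<Rightarrow> ('b, 'm::finite) hermitian_structure \<Rightarrow> ('a \<Rightarrow> 'b) \<Rightarrow> bool" where
  "conformal_map X Y f \<longleftrightarrow> (\<exists>k>0. \<forall>c\<in>holo_charts X. \<forall>d\<in>holo_charts Y.
     \<forall>p\<in>chart_dom c \<inter> f -` chart_dom d. \<forall>u v.
       let J = frechet_derivative (local_rep c d f) (at (chart_map c p))
       in herm_form (metric Y d (chart_map d (f p))) (J u) (J v)
          = complex_of_real k * herm_form (metric X c (chart_map c p)) u v)"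


section \<open>Totally geodesic complex submanifolds\<close>

text \<open>Embedded complex submanifolds of dimension \<open>CARD('k)\<close>, by local holomorphic parametrisations:
  immersions of open subsets of \<open>complex^'k\<close> that are homeomorphisms onto relatively open
  subsets of \<open>S\<close>.\<close>

definition complex_submanifold ::
  "'k::finite itself \<Rightarrow> ('b, 'm::finite) hermitian_structure \<Rightarrow> 'b set \<Rightarrow> bool" where
  "complex_submanifold TYPE('k) Y S \<longleftrightarrow> S \<subseteq> topspace (space_top Y) \<and>
     (\<forall>p\<in>S. \<exists>V (W :: (complex^'k) set) h. openin (space_top Y) V \<and> p \<in> V \<and> open W \<and>
        homeomorphic_map (top_of_set W) (subtopology (space_top Y) (S \<inter> V)) h \<and>
        (\<forall>d\<in>holo_charts Y. holo_on (W \<inter> h -` chart_dom d) (chart_map d \<circ> h) \<and>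
           (\<forall>w\<in>W \<inter> h -` chart_dom d. inj (frechet_derivative (chart_map d \<circ> h) (at w)))))"

text \<open>\<open>T\<^sub>pS\<close> as the velocities at \<open>p\<close> of curves in \<open>S\<close>, in the coordinates of the chart \<open>d\<close>.\<close>

definition tangent_vecs :: "('b, 'm::finite) chart \<Rightarrow> 'b set \<Rightarrow> 'b \<Rightarrow> (complex^'m) set" where
  "tangent_vecs d S p = {v. \<exists>\<gamma> \<epsilon>. \<epsilon> > 0 \<and> \<gamma> (0::real) = p \<and>
     (\<forall>t. \<bar>t\<bar> < \<epsilon> \<longrightarrow> \<gamma> t \<in> S \<inter> chart_dom d) \<and>
     ((chart_map d \<circ> \<gamma>) has_vector_derivative v) (at 0)}"

text \<open>The Riemannian metric is the real part of the Hermitian one.\<close>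

definition normal_vecs ::
  "('b, 'm::finite) hermitian_structure \<Rightarrow> ('b, 'm) chart \<Rightarrow> 'b set \<Rightarrow> 'b \<Rightarrow> (complex^'m) set" where
  "normal_vecs Y d S p = {\<eta>. \<forall>v\<in>tangent_vecs d S p.
     Re (herm_form (metric Y d (chart_map d p)) v \<eta>) = 0}"

text \<open>\<open>\<Gamma>\<^sup>l\<^sub>m\<^sub>a = \<Sum>\<^sub>t g\<^sup>l\<^sup>t \<partial>\<^sub>m g\<^sub>a\<^sub>t\<close> with \<open>t\<close> barred.\<close>

definition christoffel ::
  "('b, 'm::finite) hermitian_structure \<Rightarrow> ('b, 'm) chart \<Rightarrow> complex^'m \<Rightarrow> 'm \<Rightarrow> 'm \<Rightarrow> 'm \<Rightarrow> complex" where
  "christoffel Y d z l m a =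
     (\<Sum>t\<in>UNIV. g_inv (metric Y d z) l t * d_z m (\<lambda>x. metric Y d x $ a $ t) z)"

text \<open>The covariant derivative \<open>\<nabla>\<^sub>v W\<close> of a real vector field, where a real vector is identified with
  its (1,0)-part. For a Kaehler metric the Levi-Civita connection corresponds to the Chern
  connection under this identification.\<close>

definition covariant_deriv ::
  "('b, 'm::finite) hermitian_structure \<Rightarrow> ('b, 'm) chart \<Rightarrow> complex^'m \<Rightarrow> (complex^'m \<Rightarrow> complex^'m)
    \<Rightarrow> complex^'m \<Rightarrow> complex^'m" where
  "covariant_deriv Y d v W z = frechet_derivative W (at z) v +
     (\<chi> l. \<Sum>m\<in>UNIV. \<Sum>a\<in>UNIV. christoffel Y d z l m a * v $ m * W z $ a)"

text \<open>Vanishing of the second fundamental form of \<open>S\<close>: for every tangent vector \<open>v\<close>, every local field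
  \<open>W\<close> (near \<open>p\<close> in \<open>Y\<close>) tangent to \<open>S\<close> along \<open>S\<close>, and every normal vector \<open>\<eta>\<close>, one has
  \<open>\<langle>II(v, W), \<eta>\<rangle> = \<langle>\<nabla>\<^sub>v W, \<eta>\<rangle> = 0\<close>.\<close>

definition totally_geodesic :: "('b, 'm::finite) hermitian_structure \<Rightarrow> 'b set \<Rightarrow> bool" where
  "totally_geodesic Y S \<longleftrightarrow> (\<forall>d\<in>holo_charts Y. \<forall>p\<in>S \<inter> chart_dom d. \<forall>Q W.
     open Q \<and> chart_map d p \<in> Q \<and> Q \<subseteq> chart_img d \<and> smooth_on Q W \<and>
     (\<forall>q\<in>S \<inter> chart_dom d. chart_map d q \<in> Q \<longrightarrow> W (chart_map d q) \<in> tangent_vecs d S q) \<longrightarrow>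
     (\<forall>v\<in>tangent_vecs d S p. \<forall>\<eta>\<in>normal_vecs Y d S p.
        Re (herm_form (metric Y d (chart_map d p))
              (covariant_deriv Y d v W (chart_map d p)) \<eta>) = 0))"

definition totally_geodesic_submanifold ::
  "'k::finite itself \<Rightarrow> ('b, 'm::finite) hermitian_structure \<Rightarrow> 'b set \<Rightarrow> bool" where
  "totally_geodesic_submanifold TYPE('k) Y S \<longleftrightarrow>
     complex_submanifold TYPE('k) Y S \<and> totally_geodesic Y S"

end

theory Submission
  imports Defs
begin

text \<open>
  Let \<open>II\<close> be the second fundamental form of \<open>f\<close>. Conformality gives
  the Gauss equation \<open>\<langle>II(u,u'), II(v,v')\<rangle> = R\<^sup>Y(u,v,u',v') - k R\<^sup>X(u,v,u',v')\<close>,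
  so if both curvatures are pseudo-conformally flat, then
  \<open>\<langle>II(u,u'), II(v,v')\<rangle>\<close> is a sum of four products \<open>A\<^sub>i \<otimes> g\<close> with Hermitian \<open>A\<^sub>i\<close>.
  Put \<open>A = \<Sum> A\<^sub>i\<close>; symmetry of \<open>II\<close> yields \<open>|II(e,e)|\<^sup>2 = A(e,e) g(e,e)\<close>. If \<open>II \<noteq> 0\<close>, then
  \<open>A(e,e) > 0\<close> for some \<open>e\<close>, and the formula shows that \<open>v \<mapsto> II(e,v)\<close> is
  injective. Its values are normal, so \<open>(u, v) \<mapsto> df(u) + II(e,v)\<close> embeds a space of dimension
  \<open>2n\<close> into one of dimension \<open>N \<le> 2n - 1\<close>, a contradiction.
\<close>

section \<open>Smooth maps\<close>

text \<open>Injectivity of v |-> II(e,v) is a rigidity of two Hermitian forms on a plane. If II(e,v)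
  = 0, pairing with II(e,e), II(v,v) and II(e,v) gives three relations between the Gram matrices of
  A and g on e, v. Positivity of A(e,e) and nonnegativity of A(v,v) turn them into equality in the
  Cauchy-Schwarz inequality for g(e,v). So v would be a nonzero multiple of e, against II(e,e) being
  nonzero.

  The analytic obstacle is the passage from II = 0 to \<open>totally_geodesic\<close>. Tangent
  vectors are velocities of arbitrary curves in the image, and a field W is only known to be tangent
  at each point of it, so neither comes with a differentiable lift to X. Both cases go through
  \<open>vector_derivative_in_range\<close>: a curve that stays tangential up to a small relative
  error has tangential velocity.\<close>

lemma frechet_derivative_eqI:
  "(f has_derivative f') (at x) \<Longrightarrow> frechet_derivative f (at x) = f'"
  by (rule frechet_derivative_at[symmetric])

lemma frechet_derivative_cong_open:
  assumes "open S" "x \<in> S" "\<And>y. y \<in> S \<Longrightarrow> f y = g y"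
  shows "frechet_derivative f (at x) = frechet_derivative g (at x)"
proof -
  have "(f has_derivative f') (at x) \<longleftrightarrow> (g has_derivative f') (at x)" for f'
    using assms has_derivative_transform_within_open[OF _ assms(1,2), of f f' UNIV g]
      has_derivative_transform_within_open[OF _ assms(1,2), of g f' UNIV f] by auto
  then show ?thesis by (simp add: frechet_derivative_def)
qed

lemma Ck_on_cong:
  assumes "open S"
  shows "(\<And>y. y \<in> S \<Longrightarrow> f y = g y) \<Longrightarrow> Ck_on k S f \<Longrightarrow> Ck_on k S g"
proof (induction k arbitrary: f g)
  case 0
  then show ?case by (simp cong: continuous_on_cong)
next
  case (Suc k)
  have "g differentiable (at x)" if "x \<in> S" for x
    using Suc.prems that has_derivative_transform_within_open[OF _ \<open>open S\<close> that, of f _ UNIV g]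
    unfolding differentiable_def Ck_on.simps by blast
  moreover have "Ck_on k S (\<lambda>x. frechet_derivative g (at x) v)" for v
  proof (rule Suc.IH)
    show "Ck_on k S (\<lambda>x. frechet_derivative f (at x) v)"
      using Suc.prems by simp
    show "frechet_derivative f (at y) v = frechet_derivative g (at y) v" if "y \<in> S" for y
      by (simp add: frechet_derivative_cong_open[OF \<open>open S\<close> that Suc.prems(1)])
  qed
  ultimately show ?case by simp
qed

lemma Ck_on_bounded_linear:
  assumes "open S" "bounded_linear L"
  shows "Ck_on k S f \<Longrightarrow> Ck_on k S (\<lambda>x. L (f x))"
proof (induction k arbitrary: f)
  case 0
  then show ?case
    using bounded_linear.continuous_on[OF assms(2)] by simp
next
  case (Suc k)
  have d: "((\<lambda>x. L (f x)) has_derivative (\<lambda>v. L (frechet_derivative f (at x) v))) (at x)"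
    if "x \<in> S" for x
    using Suc.prems that
    by (auto intro!: bounded_linear.has_derivative[OF assms(2)] simp: frechet_derivative_works)
  have "Ck_on k S (\<lambda>x. frechet_derivative (\<lambda>x. L (f x)) (at x) v)" for v
    by (rule Ck_on_cong[OF \<open>open S\<close> _ Suc.IH[of "\<lambda>x. frechet_derivative f (at x) v"]])
      (use Suc.prems in \<open>auto simp: frechet_derivative_eqI[OF d]\<close>)
  then show ?case
    using d by (auto simp: differentiable_def)
qed

lemma smooth_on_bounded_linear:
  "open S \<Longrightarrow> bounded_linear L \<Longrightarrow> smooth_on S f \<Longrightarrow> smooth_on S (\<lambda>x. L (f x))"
  by (simp add: Ck_on_bounded_linear smooth_on_def)

lemma smooth_on_imp_Ck_on: "smooth_on S f \<Longrightarrow> Ck_on k S f"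
  by (simp add: smooth_on_def)

lemma smooth_on_has_derivative:
  assumes "smooth_on S f" "x \<in> S"
  shows "(f has_derivative frechet_derivative f (at x)) (at x)"
  using smooth_on_imp_Ck_on[OF assms(1), of "Suc 0"] assms(2)
  by (simp add: frechet_derivative_works)

lemma smooth_on_frechet_derivative:
  assumes "smooth_on S f"
  shows "smooth_on S (\<lambda>x. frechet_derivative f (at x) v)"
  unfolding smooth_on_def
proof
  fix k show "Ck_on k S (\<lambda>x. frechet_derivative f (at x) v)"
    using smooth_on_imp_Ck_on[OF assms, of "Suc k"] by simp
qed

lemma smooth_on_imp_continuous_on: "smooth_on S f \<Longrightarrow> continuous_on S f"
  using smooth_on_imp_Ck_on[of S f 0] by simp

text \<open>Clairaut's argument: the second difference of f over the parallelogram spanned by s u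
  and s v is symmetric in u and v. The mean value theorem, applied twice in either order, writes it
  as s^2 times a mixed derivative at a nearby point, and continuity at x does the rest.\<close>

lemma second_derivative_symmetric_real:
  fixes f :: "'a::real_normed_vector \<Rightarrow> real"
  assumes "open S" "x \<in> S"
    and f: "\<And>y. y \<in> S \<Longrightarrow> (f has_derivative Df y) (at y)"
    and u: "\<And>y. y \<in> S \<Longrightarrow> ((\<lambda>y. Df y u) has_derivative Du y) (at y)"
    and v: "\<And>y. y \<in> S \<Longrightarrow> ((\<lambda>y. Df y v) has_derivative Dv y) (at y)"
    and cu: "continuous_on S (\<lambda>y. Du y v)" and cv: "continuous_on S (\<lambda>y. Dv y u)"
  shows "Du x v = Dv x u"
proof -
  \<comment> \<open>The mean value theorem is applied first in the direction a to the difference of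
    f along two opposite sides, then in the direction b. Generic a, b serve both orders of u and
    v.\<close>
  have aux: "\<exists>\<xi> \<eta>. 0 < \<xi> \<and> \<xi> < s \<and> 0 < \<eta> \<and> \<eta> < s \<and>
      f (x + s *\<^sub>R a + s *\<^sub>R b) - f (x + s *\<^sub>R a) - f (x + s *\<^sub>R b) + f x
      = s * s * Da (x + \<xi> *\<^sub>R a + \<eta> *\<^sub>R b) b"
    if s: "s > 0" and sub: "\<And>p q. 0 \<le> p \<Longrightarrow> p \<le> s \<Longrightarrow> 0 \<le> q \<Longrightarrow> q \<le> s \<Longrightarrow> x + p *\<^sub>R a + q *\<^sub>R b \<in> S"
      and da: "\<And>y. y \<in> S \<Longrightarrow> ((\<lambda>y. Df y a) has_derivative Da y) (at y)"
    for s a b Da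
  proof -
    have d1: "((\<lambda>p. f (x + p *\<^sub>R a + q *\<^sub>R b)) has_real_derivative Df (x + p *\<^sub>R a + q *\<^sub>R b) a) (at p)"
      if "0 \<le> p" "p \<le> s" "0 \<le> q" "q \<le> s" for p q
    proof -
      have "((\<lambda>p. x + p *\<^sub>R a + q *\<^sub>R b) has_derivative (\<lambda>t. t *\<^sub>R a)) (at p)"
        by (auto intro!: derivative_eq_intros)
      from has_derivative_compose[OF this f[OF sub[OF that]]]
      have "((\<lambda>p. f (x + p *\<^sub>R a + q *\<^sub>R b)) has_derivative (\<lambda>t. Df (x + p *\<^sub>R a + q *\<^sub>R b) (t *\<^sub>R a))) (at p)" .
      moreover have "linear (Df (x + p *\<^sub>R a + q *\<^sub>R b))"
        using f[OF sub[OF that]] has_derivative_linear by blast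
      ultimately show ?thesis
        unfolding has_field_derivative_def by (simp add: linear_scale mult_commute_abs)
    qed
    have d2: "((\<lambda>q. Df (x + p *\<^sub>R a + q *\<^sub>R b) a) has_real_derivative Da (x + p *\<^sub>R a + q *\<^sub>R b) b) (at q)"
      if "0 \<le> p" "p \<le> s" "0 \<le> q" "q \<le> s" for p q
    proof -
      have "((\<lambda>q. x + p *\<^sub>R a + q *\<^sub>R b) has_derivative (\<lambda>t. t *\<^sub>R b)) (at q)"
        by (auto intro!: derivative_eq_intros)
      from has_derivative_compose[OF this da[OF sub[OF that]]]
      have "((\<lambda>q. Df (x + p *\<^sub>R a + q *\<^sub>R b) a) has_derivative (\<lambda>t. Da (x + p *\<^sub>R a + q *\<^sub>R b) (t *\<^sub>R b))) (at q)" .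
      moreover have "linear (Da (x + p *\<^sub>R a + q *\<^sub>R b))"
        using da[OF sub[OF that]] has_derivative_linear by blast
      ultimately show ?thesis
        unfolding has_field_derivative_def by (simp add: linear_scale mult_commute_abs)
    qed
    let ?F = "\<lambda>p. f (x + p *\<^sub>R a + s *\<^sub>R b) - f (x + p *\<^sub>R a + 0 *\<^sub>R b)"
    have "\<exists>\<xi>. 0 < \<xi> \<and> \<xi> < s \<and> ?F s - ?F 0
        = (s - 0) * (Df (x + \<xi> *\<^sub>R a + s *\<^sub>R b) a - Df (x + \<xi> *\<^sub>R a + 0 *\<^sub>R b) a)"
      by (intro MVT2 DERIV_diff d1) (use s in auto)
    then obtain \<xi> where xi: "0 < \<xi>" "\<xi> < s" "?F s - ?F 0
        = s * (Df (x + \<xi> *\<^sub>R a + s *\<^sub>R b) a - Df (x + \<xi> *\<^sub>R a + 0 *\<^sub>R b) a)"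
      by auto
    have "\<exists>\<eta>. 0 < \<eta> \<and> \<eta> < s \<and> Df (x + \<xi> *\<^sub>R a + s *\<^sub>R b) a - Df (x + \<xi> *\<^sub>R a + 0 *\<^sub>R b) a
        = (s - 0) * Da (x + \<xi> *\<^sub>R a + \<eta> *\<^sub>R b) b"
      by (intro MVT2 d2) (use s xi in auto)
    then obtain \<eta> where "0 < \<eta>" "\<eta> < s" "Df (x + \<xi> *\<^sub>R a + s *\<^sub>R b) a - Df (x + \<xi> *\<^sub>R a + 0 *\<^sub>R b) a
        = s * Da (x + \<xi> *\<^sub>R a + \<eta> *\<^sub>R b) b"
      by auto
    with xi show ?thesis
      by (intro exI[of _ \<xi>] exI[of _ \<eta>]) (simp add: algebra_simps)
  qed
  have "\<bar>Du x v - Dv x u\<bar> \<le> e" if "e > 0" for e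
  proof -
    have "isCont (\<lambda>y. Du y v) x" "isCont (\<lambda>y. Dv y u) x"
      using cu cv assms(1,2) by (auto simp: continuous_on_eq_continuous_at)
    then have "\<exists>d>0. \<forall>y. dist y x < d \<longrightarrow> dist (Du y v) (Du x v) < e/2"
      "\<exists>d>0. \<forall>y. dist y x < d \<longrightarrow> dist (Dv y u) (Dv x u) < e/2"
      using half_gt_zero[OF \<open>e > 0\<close>] unfolding continuous_at_eps_delta by blast+
    then obtain d1 d2 where d: "d1 > 0" "d2 > 0"
        "\<And>y. dist y x < d1 \<Longrightarrow> dist (Du y v) (Du x v) < e/2"
        "\<And>y. dist y x < d2 \<Longrightarrow> dist (Dv y u) (Dv x u) < e/2"
      by blast
    obtain d3 where d3: "d3 > 0" "ball x d3 \<subseteq> S"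
      using assms(1,2) open_contains_ball by blast
    define \<delta> where "\<delta> = min d1 (min d2 d3)"
    \<comment> \<open>With this side length the closed parallelogram stays at distance less than
      \<delta> from x; the summand 1 keeps the denominator positive.\<close>
    define s where "s = \<delta> / (1 + norm u + norm v)"
    have pos: "1 + norm u + norm v > 0"
      by (simp add: add_pos_nonneg)
    have "\<delta> > 0" using d d3 by (simp add: \<delta>_def)
    with pos have s: "s > 0" by (simp add: s_def)
    have near: "norm (p *\<^sub>R u + q *\<^sub>R v) < \<delta>" if "0 \<le> p" "p \<le> s" "0 \<le> q" "q \<le> s" for p q
    proof -
      have "norm (p *\<^sub>R u + q *\<^sub>R v) \<le> p * norm u + q * norm v"
        using norm_triangle_ineq[of "p *\<^sub>R u" "q *\<^sub>R v"] that by simp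
      also have "\<dots> \<le> s * norm u + s * norm v"
        using that by (intro add_mono mult_right_mono) auto
      also have "\<dots> < s * (1 + norm u + norm v)"
        using s by (simp add: algebra_simps)
      also have "\<dots> = \<delta>" using pos by (simp add: s_def)
      finally show ?thesis .
    qed
    have near1: "dist (x + p *\<^sub>R u + q *\<^sub>R v) x < \<delta>" if "0 \<le> p" "p \<le> s" "0 \<le> q" "q \<le> s" for p q
      using near[OF that] by (simp add: dist_norm add.assoc)
    have near2: "dist (x + q *\<^sub>R v + p *\<^sub>R u) x < \<delta>" if "0 \<le> p" "p \<le> s" "0 \<le> q" "q \<le> s" for p q
      using near1[OF that] by (simp add: ac_simps)
    have inS: "y \<in> S" if "dist y x < \<delta>" for y
      using that d3 by (auto simp: \<delta>_def dist_commute subset_iff)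
    obtain \<xi> \<eta> where 1: "0 < \<xi>" "\<xi> < s" "0 < \<eta>" "\<eta> < s"
      "f (x + s *\<^sub>R u + s *\<^sub>R v) - f (x + s *\<^sub>R u) - f (x + s *\<^sub>R v) + f x
        = s * s * Du (x + \<xi> *\<^sub>R u + \<eta> *\<^sub>R v) v"
      using aux[OF s, of u v Du] inS near1 u by blast
    obtain \<xi>' \<eta>' where 2: "0 < \<xi>'" "\<xi>' < s" "0 < \<eta>'" "\<eta>' < s"
      "f (x + s *\<^sub>R v + s *\<^sub>R u) - f (x + s *\<^sub>R v) - f (x + s *\<^sub>R u) + f x
        = s * s * Dv (x + \<xi>' *\<^sub>R v + \<eta>' *\<^sub>R u) u"
      using aux[OF s, of v u Dv] inS near2 v by blast
    have "s * s * Du (x + \<xi> *\<^sub>R u + \<eta> *\<^sub>R v) v = s * s * Dv (x + \<xi>' *\<^sub>R v + \<eta>' *\<^sub>R u) u"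
      using 1(5) 2(5) by (simp add: algebra_simps)
    then have "Du (x + \<xi> *\<^sub>R u + \<eta> *\<^sub>R v) v = Dv (x + \<xi>' *\<^sub>R v + \<eta>' *\<^sub>R u) u"
      using s by simp
    moreover have "dist (Du (x + \<xi> *\<^sub>R u + \<eta> *\<^sub>R v) v) (Du x v) < e/2"
      using near1[of \<xi> \<eta>] 1 by (intro d) (simp add: \<delta>_def)
    moreover have "dist (Dv (x + \<xi>' *\<^sub>R v + \<eta>' *\<^sub>R u) u) (Dv x u) < e/2"
      using near2[of \<eta>' \<xi>'] 2 by (intro d) (simp add: \<delta>_def)
    ultimately show ?thesis
      unfolding dist_real_def by linarith
  qed
  then have "\<bar>Du x v - Dv x u\<bar> \<le> 0"
    by (rule field_le_epsilon) simp
  then show ?thesis by simp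
qed

text \<open>The mean value theorem needs real values, so the claim is checked on the coordinates
  with respect to \<open>Basis\<close>.\<close>

lemma second_derivative_symmetric:
  fixes f :: "'a::real_normed_vector \<Rightarrow> 'b::euclidean_space"
  assumes "open S" "smooth_on S f" "x \<in> S"
  shows "frechet_derivative (\<lambda>y. frechet_derivative f (at y) u) (at x) v
       = frechet_derivative (\<lambda>y. frechet_derivative f (at y) v) (at x) u"
proof (rule euclidean_eqI)
  fix b :: 'b assume "b \<in> Basis"
  have bl: "bounded_linear (\<lambda>y. y \<bullet> b)"
    by (rule bounded_linear_inner_left)
  have *: "((\<lambda>y. h y \<bullet> b) has_derivative (\<lambda>t. frechet_derivative h (at y) t \<bullet> b)) (at y)"
    if "smooth_on S h" "y \<in> S" for h :: "'a \<Rightarrow> 'b" and y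
    using bounded_linear.has_derivative[OF bl smooth_on_has_derivative[OF that]] .
  have **: "continuous_on S (\<lambda>y. frechet_derivative (\<lambda>y. frechet_derivative f (at y) p) (at y) q \<bullet> b)" for p q
    by (intro bounded_linear.continuous_on[OF bl] smooth_on_imp_continuous_on smooth_on_frechet_derivative assms)
  show "frechet_derivative (\<lambda>y. frechet_derivative f (at y) u) (at x) v \<bullet> b
       = frechet_derivative (\<lambda>y. frechet_derivative f (at y) v) (at x) u \<bullet> b"
    by (rule second_derivative_symmetric_real[OF assms(1,3) *[OF assms(2)]
        *[OF smooth_on_frechet_derivative[OF assms(2)]] *[OF smooth_on_frechet_derivative[OF assms(2)]] ** **])
qed

text \<open>Symmetry of second derivatives moves the direction \<open>c *s u\<close> to the inner
  differentiation, where the Cauchy-Riemann condition on f pulls c out.\<close>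

lemma holo_on_frechet_derivative:
  assumes "open S" "holo_on S f"
  shows "holo_on S (\<lambda>x. frechet_derivative f (at x) v)"
  unfolding holo_on_def
proof (intro conjI ballI allI)
  have sm: "smooth_on S f" using assms by (simp add: holo_on_def)
  then show "smooth_on S (\<lambda>x. frechet_derivative f (at x) v)"
    by (rule smooth_on_frechet_derivative)
  fix z c u assume z: "z \<in> S"
  have bl: "bounded_linear (\<lambda>w::complex^'b. c *s w)"
    by (intro linear_conv_bounded_linear[THEN iffD1] linearI)
       (simp_all add: vec_eq_iff algebra_simps)
  have "frechet_derivative (\<lambda>x. frechet_derivative f (at x) v) (at z) (c *s u)
      = frechet_derivative (\<lambda>x. frechet_derivative f (at x) (c *s u)) (at z) v"
    by (rule second_derivative_symmetric[OF assms(1) sm z])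
  also have "frechet_derivative (\<lambda>x. frechet_derivative f (at x) (c *s u)) (at z)
     = frechet_derivative (\<lambda>x. c *s frechet_derivative f (at x) u) (at z)"
    using assms z by (intro frechet_derivative_cong_open[of S]) (auto simp: holo_on_def)
  also have "\<dots> = (\<lambda>t. c *s frechet_derivative (\<lambda>x. frechet_derivative f (at x) u) (at z) t)"
    by (intro frechet_derivative_eqI bounded_linear.has_derivative[OF bl] smooth_on_has_derivative[OF _ z]
        smooth_on_frechet_derivative sm)
  also have "frechet_derivative (\<lambda>x. frechet_derivative f (at x) u) (at z) v
      = frechet_derivative (\<lambda>x. frechet_derivative f (at x) v) (at z) u"
    by (rule second_derivative_symmetric[OF assms(1) sm z])
  finally show "frechet_derivative (\<lambda>x. frechet_derivative f (at x) v) (at z) (c *s u)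
      = c *s frechet_derivative (\<lambda>x. frechet_derivative f (at x) v) (at z) u" .
qed

section \<open>Hermitian forms and Wirtinger calculus\<close>

lemma herm_form_add_left: "herm_form G (u + u') v = herm_form G u v + herm_form G u' v"
  and herm_form_add_right: "herm_form G u (v + v') = herm_form G u v + herm_form G u v'"
  and herm_form_add_matrix: "herm_form (G + G') u v = herm_form G u v + herm_form G' u v"
  unfolding herm_form_def by (simp_all add: ring_distribs sum.distrib)

lemma herm_form_diff_left: "herm_form G (u - u') v = herm_form G u v - herm_form G u' v"
  and herm_form_diff_right: "herm_form G u (v - v') = herm_form G u v - herm_form G u v'"
  unfolding herm_form_def by (simp_all add: ring_distribs sum_subtractf)

lemma herm_form_scale_left: "herm_form G (c *s u) v = c * herm_form G u v"
  and herm_form_scale_right: "herm_form G u (c *s v) = cnj c * herm_form G u v"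
  unfolding herm_form_def by (simp_all add: sum_distrib_left ac_simps)

lemma herm_form_zero_left [simp]: "herm_form G 0 v = 0"
  and herm_form_zero_right [simp]: "herm_form G u 0 = 0"
  unfolding herm_form_def by simp_all

lemma herm_form_axis: "herm_form G (axis a 1) (axis b 1) = G $ a $ b"
proof -
  have "herm_form G (axis a 1) (axis b 1)
      = (\<Sum>i\<in>UNIV. if i = a then \<Sum>j\<in>UNIV. if j = b then G $ i $ j else 0 else 0)"
    unfolding herm_form_def by (intro sum.cong refl) (simp add: axis_def if_distrib cong: if_cong)
  then show ?thesis by simp
qed

lemma herm_form_sum_left: "herm_form G (\<Sum>i\<in>I. u i) v = (\<Sum>i\<in>I. herm_form G (u i) v)"
  by (induction I rule: infinite_finite_induct) (simp_all add: herm_form_add_left)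

lemma herm_form_sum_right: "herm_form G u (\<Sum>i\<in>I. v i) = (\<Sum>i\<in>I. herm_form G u (v i))"
  by (induction I rule: infinite_finite_induct) (simp_all add: herm_form_add_right)

lemma hermitian_matrix_cnj: "hermitian_matrix G \<Longrightarrow> cnj (G $ a $ b) = G $ b $ a"
  unfolding hermitian_matrix_def by (metis complex_cnj_cnj)

lemma herm_form_cnj:
  assumes "hermitian_matrix G"
  shows "herm_form G v u = cnj (herm_form G u v)"
  unfolding herm_form_def
  by (subst sum.swap) (simp add: hermitian_matrix_cnj[OF assms] ac_simps)

lemma herm_form_self_real:
  assumes "hermitian_matrix G"
  shows "herm_form G u u = of_real (Re (herm_form G u u))"
  using arg_cong[OF herm_form_cnj[OF assms, of u u], of Im] by (simp add: complex_eq_iff)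

lemma herm_form_self_eq_0: "positive_matrix G \<Longrightarrow> herm_form G u u = 0 \<longleftrightarrow> u = 0"
  by (cases "u = 0") (auto simp: positive_matrix_def dest: spec[of _ u])

lemma positive_matrix_invertible:
  fixes G :: "complex^'n^'n::finite"
  assumes "positive_matrix G"
  shows "invertible G"
proof -
  have "w = 0" if "G *v w = 0" for w
  proof -
    \<comment> \<open>\<open>herm_form\<close> conjugates its second argument, so conjugating w
      makes w itself, and hence G w, appear.\<close>
    define x where "x = (\<chi> b. cnj (w $ b))"
    have "herm_form G x x = (\<Sum>a\<in>UNIV. x $ a * ((G *v w) $ a))"
      unfolding herm_form_def by (simp add: x_def matrix_vector_mult_def sum_distrib_left ac_simps)
    with that have "x = 0"
      using herm_form_self_eq_0[OF assms] by simp
    then show ?thesis by (simp add: x_def vec_eq_iff)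
  qed
  then show ?thesis
    by (simp add: invertible_left_inverse matrix_left_invertible_ker)
qed

text \<open>Because of the transposition in \<open>g_inv\<close>, contracting the first index is the
  left inverse identity and contracting the second index is the right one.\<close>

lemma g_inv_right:
  assumes "positive_matrix G"
  shows "(\<Sum>s\<in>UNIV. g_inv G s t * G $ s $ c) = (if t = c then 1 else 0)"
    and "(\<Sum>t\<in>UNIV. g_inv G s t * G $ c $ t) = (if s = c then 1 else 0)"
proof -
  have "matrix_inv G ** G = mat 1" "G ** matrix_inv G = mat 1"
    using someI_ex[OF positive_matrix_invertible[OF assms, unfolded invertible_def], folded matrix_inv_def]
    by simp_all
  then have "(matrix_inv G ** G) $ t $ c = mat 1 $ t $ c" "(G ** matrix_inv G) $ c $ s = mat 1 $ c $ s"
    by simp_all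
  then show "(\<Sum>s\<in>UNIV. g_inv G s t * G $ s $ c) = (if t = c then 1 else 0)"
    and "(\<Sum>t\<in>UNIV. g_inv G s t * G $ c $ t) = (if s = c then 1 else 0)"
    by (auto simp: g_inv_def matrix_matrix_mult_def mat_def ac_simps)
qed

section \<open>Wirtinger derivatives of Hermitian expressions and composites\<close>

lemma d_z_eqI: "(f has_derivative f') (at z) \<Longrightarrow> d_z i f z = (f' (axis i 1) - \<i> * f' (axis i \<i>)) / 2"
  and d_zbar_eqI: "(f has_derivative f') (at z) \<Longrightarrow> d_zbar i f z = (f' (axis i 1) + \<i> * f' (axis i \<i>)) / 2"
  by (simp_all add: d_z_def d_zbar_def frechet_derivative_eqI)

lemma d_z_cong_open:
  assumes "open S" "x \<in> S" "\<And>y. y \<in> S \<Longrightarrow> f y = g y"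
  shows "d_z i f x = d_z i g x" "d_zbar i f x = d_zbar i g x"
  using frechet_derivative_cong_open[OF assms] by (simp_all add: d_z_def d_zbar_def)

definition clinear_map :: "(complex^'n::finite \<Rightarrow> complex^'m::finite) \<Rightarrow> bool" where
  "clinear_map L \<longleftrightarrow> linear L \<and> (\<forall>c v. L (c *s v) = c *s L v)"

lemma clinear_map_axis: "clinear_map L \<Longrightarrow> L (axis i c) = c *s L (axis i 1)"
proof -
  have "axis i c = c *s axis i (1::complex)"
    by (simp add: vec_eq_iff axis_def)
  then show "clinear_map L \<Longrightarrow> L (axis i c) = c *s L (axis i 1)"
    by (simp add: clinear_map_def)
qed

lemma clinear_map_expand:
  assumes "clinear_map L"
  shows "L u = (\<Sum>a\<in>UNIV. u $ a *s L (axis a 1))"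
proof -
  have "L u = L (\<Sum>a\<in>UNIV. axis a (u $ a))"
    by (rule arg_cong[of _ _ L]) (simp add: vec_eq_iff axis_def if_distrib cong: if_cong)
  also have "\<dots> = (\<Sum>a\<in>UNIV. L (axis a (u $ a)))"
    using assms by (simp add: clinear_map_def linear_sum)
  also have "\<dots> = (\<Sum>a\<in>UNIV. u $ a *s L (axis a 1))"
    by (intro sum.cong refl clinear_map_axis[OF assms])
  finally show ?thesis .
qed

lemma holo_on_clinear:
  assumes "holo_on S f" "z \<in> S"
  shows "clinear_map (frechet_derivative f (at z))"
  using assms has_derivative_linear[OF smooth_on_has_derivative[of S f z]]
  by (simp add: holo_on_def clinear_map_def)

lemma has_derivative_vec_nth: "(f has_derivative f') F \<Longrightarrow> ((\<lambda>x. f x $ i) has_derivative (\<lambda>t. f' t $ i)) F"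
  by (rule bounded_linear.has_derivative[OF bounded_linear_vec_nth])

lemma has_derivative_cnj_comp: "(f has_derivative f') F \<Longrightarrow> ((\<lambda>x. cnj (f x)) has_derivative (\<lambda>t. cnj (f' t))) F"
  by (rule bounded_linear.has_derivative[OF bounded_linear_cnj])

lemma has_derivative_herm_form:
  assumes G: "\<And>a b. ((\<lambda>x. G x $ a $ b) has_derivative G' a b) (at z)"
    and "(u has_derivative u') (at z)" "(v has_derivative v') (at z)"
  shows "((\<lambda>x. herm_form (G x) (u x) (v x)) has_derivative
     (\<lambda>t. herm_form (\<chi> a b. G' a b t) (u z) (v z) + herm_form (G z) (u' t) (v z)
       + herm_form (G z) (u z) (v' t))) (at z)"
proof -
  have u: "((\<lambda>x. u x $ a) has_derivative (\<lambda>t. u' t $ a)) (at z)" for a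
    by (intro has_derivative_vec_nth assms)
  have v: "((\<lambda>x. cnj (v x $ a)) has_derivative (\<lambda>t. cnj (v' t $ a))) (at z)" for a
    by (intro has_derivative_cnj_comp has_derivative_vec_nth assms)
  show ?thesis
    unfolding herm_form_def
    by (rule has_derivative_eq_rhs[OF has_derivative_sum[OF has_derivative_sum[OF
        has_derivative_mult[OF has_derivative_mult[OF G u] v]]]])
      (simp add: fun_eq_iff sum.distrib[symmetric] algebra_simps)
qed

text \<open>The second slot is conjugate-linear. When u and v have complex linear derivatives, the
  contributions of v to \<open>d_z\<close> and of u to \<open>d_zbar\<close> cancel between the
  directions 1 and \<i>.\<close>

lemma
  assumes G: "\<And>a b. ((\<lambda>x. G x $ a $ b) has_derivative G' a b) (at z)"
    and "(u has_derivative u') (at z)" "(v has_derivative v') (at z)"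
    and u': "clinear_map u'" and v': "clinear_map v'"
  shows d_z_herm_form: "d_z m (\<lambda>x. herm_form (G x) (u x) (v x)) z
      = herm_form (\<chi> a b. d_z m (\<lambda>x. G x $ a $ b) z) (u z) (v z) + herm_form (G z) (u' (axis m 1)) (v z)" (is ?A)
    and d_zbar_herm_form: "d_zbar m (\<lambda>x. herm_form (G x) (u x) (v x)) z
      = herm_form (\<chi> a b. d_zbar m (\<lambda>x. G x $ a $ b) z) (u z) (v z) + herm_form (G z) (u z) (v' (axis m 1))" (is ?B)
proof -
  note D = has_derivative_herm_form[OF assms(1-3)]
  have 1: "herm_form (\<chi> a b. d_z m (\<lambda>x. G x $ a $ b) z) p q
      = (herm_form (\<chi> a b. G' a b (axis m 1)) p q - \<i> * herm_form (\<chi> a b. G' a b (axis m \<i>)) p q) / 2" for p q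
    unfolding d_z_eqI[OF G]
    by (simp add: herm_form_def sum_divide_distrib sum_distrib_left sum_subtractf[symmetric] algebra_simps
        diff_divide_distrib)
  have 2: "herm_form (\<chi> a b. d_zbar m (\<lambda>x. G x $ a $ b) z) p q
      = (herm_form (\<chi> a b. G' a b (axis m 1)) p q + \<i> * herm_form (\<chi> a b. G' a b (axis m \<i>)) p q) / 2" for p q
    unfolding d_zbar_eqI[OF G]
    by (simp add: herm_form_def sum_divide_distrib sum_distrib_left sum.distrib[symmetric] algebra_simps
        add_divide_distrib)
  show ?A ?B
    unfolding d_z_eqI[OF D] d_zbar_eqI[OF D] 1 2
      clinear_map_axis[OF u', of m \<i>] clinear_map_axis[OF v', of m \<i>] herm_form_scale_left herm_form_scale_right
    by (simp_all add: field_simps)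
qed

lemma wirtinger_expand:
  assumes H: "(H has_derivative H') (at y)"
  shows "H' w = (\<Sum>l\<in>UNIV. w $ l * d_z l H y + cnj (w $ l) * d_zbar l H y)"
proof -
  have lin: "linear H'" using H has_derivative_linear by blast
  \<comment> \<open>\<open>H'\<close> is only real-linear, so a complex coordinate has to be split
    into its real and imaginary parts.\<close>
  have ax: "axis l (c::complex) = Re c *\<^sub>R axis l 1 + Im c *\<^sub>R axis l \<i>" for l :: 'a and c
    by (simp add: vec_eq_iff axis_def complex_eq_iff)
  have "H' (axis l c) = c * d_z l H y + cnj c * d_zbar l H y" for l c
  proof -
    have "H' (axis l c) = of_real (Re c) * H' (axis l 1) + of_real (Im c) * H' (axis l \<i>)"
      unfolding ax[of l c] linear_add[OF lin] linear_scale[OF lin] by (simp add: scaleR_conv_of_real)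
    also have "\<dots> = c * d_z l H y + cnj c * d_zbar l H y"
      unfolding d_z_eqI[OF H] d_zbar_eqI[OF H]
      by (simp add: complex_eq_iff field_simps)
    finally show ?thesis .
  qed
  moreover have "H' w = H' (\<Sum>a\<in>UNIV. axis a (w $ a))"
    by (rule arg_cong[of _ _ H']) (simp add: vec_eq_iff axis_def if_distrib cong: if_cong)
  ultimately show ?thesis
    by (simp add: linear_sum[OF lin])
qed

lemma
  assumes H: "(H has_derivative H') (at (F z))" and F: "(F has_derivative F') (at z)" and "clinear_map F'"
  shows d_z_compose: "d_z i (\<lambda>x. H (F x)) z = (\<Sum>l\<in>UNIV. F' (axis i 1) $ l * d_z l H (F z))"
    and d_zbar_compose: "d_zbar i (\<lambda>x. H (F x)) z = (\<Sum>l\<in>UNIV. cnj (F' (axis i 1) $ l) * d_zbar l H (F z))"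
proof -
  note HF = has_derivative_compose[OF F H]
  \<comment> \<open>P and Q are the complex linear and the antilinear part of the derivative of the
    composite; replacing the direction 1 by \<i> multiplies them by \<i> and -\<i>.\<close>
  define P where "P = (\<Sum>l\<in>UNIV. F' (axis i 1) $ l * d_z l H (F z))"
  define Q where "Q = (\<Sum>l\<in>UNIV. cnj (F' (axis i 1) $ l) * d_zbar l H (F z))"
  have "H' (F' (axis i 1)) = P + Q" "H' (F' (axis i \<i>)) = \<i> * P - \<i> * Q"
    unfolding clinear_map_axis[OF assms(3), of i \<i>] wirtinger_expand[OF H] P_def Q_def
    by (simp_all add: sum.distrib sum_distrib_left sum_negf sum_subtractf ac_simps)
  note eqs = this
  show "d_z i (\<lambda>x. H (F x)) z = P" "d_zbar i (\<lambda>x. H (F x)) z = Q"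
    unfolding d_z_eqI[OF HF] d_zbar_eqI[OF HF] eqs by (simp_all add: algebra_simps)
qed

lemma d_zbar_cnj:
  assumes "(H has_derivative H') (at y)"
  shows "d_zbar l (\<lambda>x. cnj (H x)) y = cnj (d_z l H y)"
  unfolding d_z_eqI[OF assms] d_zbar_eqI[OF has_derivative_cnj_comp[OF assms]] by simp

lemma d_z_sum:
  assumes "\<And>i. i \<in> I \<Longrightarrow> (f i has_derivative f' i) (at z)"
  shows "d_z m (\<lambda>x. \<Sum>i\<in>I. f i x) z = (\<Sum>i\<in>I. d_z m (f i) z)"
proof -
  have "(\<Sum>i\<in>I. d_z m (f i) z) = (\<Sum>i\<in>I. (f' i (axis m 1) - \<i> * f' i (axis m \<i>)) / 2)"
    by (intro sum.cong refl d_z_eqI assms)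
  moreover have "((\<lambda>x. \<Sum>i\<in>I. f i x) has_derivative (\<lambda>t. \<Sum>i\<in>I. f' i t)) (at z)"
    by (intro has_derivative_sum assms)
  ultimately show ?thesis
    by (simp add: d_z_eqI sum_subtractf sum_distrib_left sum_divide_distrib diff_divide_distrib)
qed

lemma d_z_add:
  assumes "(f has_derivative f') (at z)" "(g has_derivative g') (at z)"
  shows "d_z m (\<lambda>x. f x + g x) z = d_z m f z + d_z m g z"
  unfolding d_z_eqI[OF has_derivative_add[OF assms]] assms[THEN d_z_eqI] by (simp add: field_simps)

lemma
  assumes "(f has_derivative f') (at z)"
  shows d_z_cmult: "d_z m (\<lambda>x. c * f x) z = c * d_z m f z"
    and d_zbar_cmult: "d_zbar m (\<lambda>x. c * f x) z = c * d_zbar m f z"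
  unfolding d_z_eqI[OF has_derivative_mult_right[OF assms]] d_zbar_eqI[OF has_derivative_mult_right[OF assms]]
    assms[THEN d_z_eqI] assms[THEN d_zbar_eqI] by (simp_all add: field_simps)

text \<open>\<open>d_z\<close> kills the conjugate of a function with complex linear derivative,
  which therefore acts as a constant factor.\<close>

lemma d_z_antiholo_mult:
  assumes u: "(u has_derivative u') (at z)" "clinear_map u'" and H: "(H has_derivative H') (at z)"
  shows "d_z m (\<lambda>x. cnj (u x $ l) * H x) z = cnj (u z $ l) * d_z m H z"
  unfolding d_z_eqI[OF H] d_z_eqI[OF has_derivative_mult[OF has_derivative_cnj_comp[OF has_derivative_vec_nth[OF u(1)]] H]]
    clinear_map_axis[OF u(2), of m \<i>]
  by (simp add: field_simps)

section \<open>Flat second fundamental forms\<close>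

lemma clinear_map_zero: "clinear_map L \<Longrightarrow> L 0 = 0"
  by (simp add: clinear_map_def linear_0)

lemma clinear_map_add: "clinear_map L \<Longrightarrow> L (u + v) = L u + L v"
  by (simp add: clinear_map_def linear_add)

lemma clinear_map_diff: "clinear_map L \<Longrightarrow> L (u - v) = L u - L v"
  by (simp add: clinear_map_def linear_diff)

lemma clinear_map_scale: "clinear_map L \<Longrightarrow> L (c *s v) = c *s L v"
  by (simp add: clinear_map_def)

lemma hermitian_matrix_add: "hermitian_matrix A \<Longrightarrow> hermitian_matrix B \<Longrightarrow> hermitian_matrix (A + B)"
  unfolding hermitian_matrix_def by (metis vector_add_component complex_cnj_add)

text \<open>Here a, x, c are the Gram entries of g on two vectors e, v, and \<alpha>, s, \<gamma>
  those of A; the relations express II(e,v) = 0. The first gives s = -(\<alpha>/a) x. If x were 0,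
  the third would contradict \<alpha> c > 0. Hence the second yields \<gamma> a = \<alpha> c, and
  the third becomes equality in Cauchy-Schwarz.\<close>

lemma degenerate_pencil_zero:
  fixes x s :: complex and a c \<alpha> \<gamma> :: real
  assumes "a > 0" "\<alpha> > 0" "c > 0" "\<gamma> \<ge> 0"
    and i: "\<alpha> * cnj x + cnj s * a = 0"
    and ii: "s * c + \<gamma> * x = 0"
    and iii: "\<alpha> * c + cnj s * x + s * cnj x + \<gamma> * a = 0"
  shows "x \<noteq> 0" "a * c = (norm x)\<^sup>2"
proof -
  have "cnj (\<alpha> * cnj x + cnj s * a) = 0" using i by simp
  then have "\<alpha> * x + s * a = 0" by simp
  then have "s * a = - (\<alpha> * x)"
    by (simp only: eq_neg_iff_add_eq_0 add.commute)
  then have "s = (- (\<alpha> * x)) / a"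
    by (intro nonzero_eq_divide_eq[THEN iffD2]) (use \<open>a > 0\<close> in auto)
  then have s: "s = - (\<alpha> / a) * x" by simp
  show x: "x \<noteq> 0"
  proof
    assume "x = 0"
    with iii have "of_real (\<alpha> * c + \<gamma> * a) = (0::complex)" by simp
    then have "\<alpha> * c + \<gamma> * a = 0" by (simp only: of_real_eq_0_iff)
    moreover have "\<alpha> * c > 0" "\<gamma> * a \<ge> 0" using assms by simp_all
    ultimately show False by linarith
  qed
  have "x * of_real (\<gamma> - \<alpha> * c / a) = s * c + \<gamma> * x"
    unfolding s by (simp add: algebra_simps)
  then have "of_real (\<gamma> - \<alpha> * c / a) = (0::complex)"
    using ii x by (simp only: mult_eq_0_iff) simp
  then have "\<gamma> - \<alpha> * c / a = 0"
    by (simp only: of_real_eq_0_iff)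
  then have \<gamma>: "\<gamma> * a = \<alpha> * c"
    using \<open>a > 0\<close> by (simp add: field_simps)
  have "cnj s * x + s * cnj x = - (2 * (\<alpha> / a)) * (x * cnj x)"
    unfolding s by simp
  also have "x * cnj x = of_real ((norm x)\<^sup>2)"
    by (rule complex_norm_square[symmetric])
  finally have *: "cnj s * x + s * cnj x = of_real (- (2 * (\<alpha> / a)) * (norm x)\<^sup>2)"
    by simp
  have "of_real (\<alpha> * c + \<gamma> * a + - (2 * (\<alpha> / a)) * (norm x)\<^sup>2)
      = \<alpha> * c + cnj s * x + s * cnj x + \<gamma> * a"
    unfolding of_real_add *[symmetric] by simp
  then have "\<alpha> * c + \<gamma> * a + - (2 * (\<alpha> / a)) * (norm x)\<^sup>2 = 0"
    unfolding iii by (simp only: of_real_eq_0_iff)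
  then have "2 * \<alpha> * (c - (norm x)\<^sup>2 / a) = 0"
    unfolding \<gamma> by (simp add: right_diff_distrib)
  then have "c = (norm x)\<^sup>2 / a" using \<open>\<alpha> > 0\<close> by simp
  then show "a * c = (norm x)\<^sup>2" using \<open>a > 0\<close> by simp
qed

text \<open>The algebra at one point: \<open>J\<close> is the differential, \<open>G\<close> and
  \<open>g\<close> are the metrics of Y and X. The closing dimension count is over the reals, 4
  \<open>CARD('n)\<close> against 2 \<open>CARD('m)\<close>.\<close>

lemma flat_second_fundamental_form_zero:
  fixes J :: "complex^'n::finite \<Rightarrow> complex^'m::finite"
    and II :: "complex^'n \<Rightarrow> complex^'n \<Rightarrow> complex^'m"
  assumes dim: "CARD('m) < 2 * CARD('n)"
    and G: "hermitian_matrix G" "positive_matrix G" and g: "hermitian_matrix g" "positive_matrix g"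
    and A: "hermitian_matrix A1" "hermitian_matrix A2" "hermitian_matrix A3" "hermitian_matrix A4"
    and J: "clinear_map J" "inj J"
    and II: "\<And>u. clinear_map (II u)" and sym: "\<And>u v. II u v = II v u"
    and orth: "\<And>u v w. herm_form G (II u v) (J w) = 0"
    and flat: "\<And>u u' v v'. herm_form G (II u u') (II v v')
       = herm_form A1 u v * herm_form g u' v' + herm_form A2 u' v * herm_form g u v'
       + herm_form A3 u v' * herm_form g u' v + herm_form A4 u' v' * herm_form g u v"
  shows "II u v = 0"
proof (rule ccontr)
  assume nz: "II u v \<noteq> 0"
  define A where "A = A1 + A2 + A3 + A4"
  have hA: "hermitian_matrix A"
    unfolding A_def by (intro hermitian_matrix_add assms)
  \<comment> \<open>II does not see the swaps of u with u' and of v with v'. Summing over these four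
    arrangements lets every one of the four product patterns collect all of A1, ..., A4.\<close>
  have quad: "4 * herm_form G (II u u') (II v v')
      = herm_form A u v * herm_form g u' v' + herm_form A u' v * herm_form g u v'
       + herm_form A u v' * herm_form g u' v + herm_form A u' v' * herm_form g u v" for u u' v v'
  proof -
    have "4 * herm_form G (II u u') (II v v') = herm_form G (II u u') (II v v') + herm_form G (II u' u) (II v v')
       + herm_form G (II u u') (II v' v) + herm_form G (II u' u) (II v' v)"
      using sym[of u' u] sym[of v' v] by simp
    then show ?thesis
      unfolding flat A_def herm_form_add_matrix by (simp add: algebra_simps)
  qed
  have sq: "herm_form G (II e e) (II e e) = of_real (Re (herm_form A e e) * Re (herm_form g e e))" for e
  proof -
    have "4 * herm_form G (II e e) (II e e) = 4 * (herm_form A e e * herm_form g e e)"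
      by (subst quad) simp
    then have "herm_form G (II e e) (II e e) = herm_form A e e * herm_form g e e"
      by simp
    also have "herm_form A e e = of_real (Re (herm_form A e e))"
      by (rule herm_form_self_real[OF hA])
    also have "herm_form g e e = of_real (Re (herm_form g e e))"
      by (rule herm_form_self_real[OF g(1)])
    finally show ?thesis by simp
  qed
  have gpos: "Re (herm_form g w w) > 0" if "w \<noteq> 0" for w
    using g(2) that by (simp add: positive_matrix_def)
  have Apos: "Re (herm_form A w w) > 0" if "II w w \<noteq> 0" for w
  proof -
    have "w \<noteq> 0" using that clinear_map_zero[OF II] by blast
    moreover have "Re (herm_form G (II w w) (II w w)) > 0"
      using G(2) that by (simp add: positive_matrix_def)
    ultimately show ?thesis
      using gpos[of w] unfolding sq by (simp add: zero_less_mult_iff)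
  qed
  \<comment> \<open>Where II(w,w) vanishes, \<open>sq\<close> forces A(w,w) = 0 for w other than 0,
    because g(w,w) > 0.\<close>
  have Anonneg: "Re (herm_form A w w) \<ge> 0" for w
  proof (cases "II w w = 0")
    case True
    then have "of_real (Re (herm_form A w w) * Re (herm_form g w w)) = (0::complex)"
      using sq[of w] by (simp only: herm_form_zero_left)
    then have "Re (herm_form A w w) * Re (herm_form g w w) = 0"
      by (simp only: of_real_eq_0_iff)
    then show ?thesis using gpos[of w] by (cases "w = 0") auto
  qed (use Apos in force)
  \<comment> \<open>Polarisation: a symmetric bilinear map that vanishes on the diagonal is
    zero.\<close>
  have "\<exists>e. II e e \<noteq> 0"
  proof (rule ccontr)
    assume "\<nexists>e. II e e \<noteq> 0"
    then have z: "II e e = 0" for e by blast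
    have "II (u + v) (u + v) = II u u + II u v + II v u + II v v"
      using sym[of "u + v"] by (simp add: clinear_map_add[OF II])
    then have "II u v + II u v = 0" using z sym[of v u] by simp
    then show False using nz by (simp add: vec_eq_iff)
  qed
  then obtain e where e: "II e e \<noteq> 0" by blast
  then have e0: "e \<noteq> 0" using clinear_map_zero[OF II] by blast
  have inj: "v = 0" if v: "II e v = 0" for v
  proof (rule ccontr)
    assume v0: "v \<noteq> 0"
    define a where "a = Re (herm_form g e e)"
    define c where "c = Re (herm_form g v v)"
    define \<alpha> where "\<alpha> = Re (herm_form A e e)"
    define \<gamma> where "\<gamma> = Re (herm_form A v v)"
    define x where "x = herm_form g e v"
    define s where "s = herm_form A e v"
    have ev: "herm_form g e e = a" "herm_form g v v = c" "herm_form A e e = \<alpha>" "herm_form A v v = \<gamma>"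
      "herm_form g e v = x" "herm_form A e v = s" "herm_form g v e = cnj x" "herm_form A v e = cnj s"
      unfolding a_def c_def \<alpha>_def \<gamma>_def x_def s_def
      using herm_form_self_real[OF hA] herm_form_self_real[OF g(1)] herm_form_cnj[OF hA] herm_form_cnj[OF g(1)]
      by blast+
    have pos: "a > 0" "\<alpha> > 0" "c > 0" "\<gamma> \<ge> 0"
      unfolding a_def \<alpha>_def c_def \<gamma>_def using gpos e0 v0 Apos[OF e] Anonneg by blast+
    \<comment> \<open>The three relations pair II(e,v) = 0 with II(e,e), II(v,v) and itself. The
      factors 2 arise where repeated arguments make the summands of \<open>quad\<close> agree in
      pairs.\<close>
    have "2 * (\<alpha> * cnj x + cnj s * a) = 0"
      using quad[of e v e e] unfolding v ev by (simp add: algebra_simps)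
    then have i: "\<alpha> * cnj x + cnj s * a = 0" by (simp only: mult_eq_0_iff) simp
    have "2 * (s * c + \<gamma> * x) = 0"
      using quad[of e v v v] unfolding v ev by (simp add: algebra_simps)
    then have ii: "s * c + \<gamma> * x = 0" by (simp only: mult_eq_0_iff) simp
    have iii: "\<alpha> * c + cnj s * x + s * cnj x + \<gamma> * a = 0"
      using quad[of e v e v] unfolding v ev by (simp add: algebra_simps)
    note x = degenerate_pencil_zero[OF pos i ii iii]
    \<comment> \<open>t = g(v,e)/g(e,e), so \<open>v - t *s e\<close> is the component of v
      orthogonal to e. Its squared length c - |x|^2/a vanishes by the equality just
      obtained.\<close>
    define t where "t = cnj x / a"
    have "herm_form g (v - t *s e) (v - t *s e) = c - cnj t * cnj x - t * x + t * cnj t * a"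
      unfolding herm_form_diff_left herm_form_diff_right herm_form_scale_left herm_form_scale_right ev
      by (simp add: algebra_simps)
    also have "\<dots> = c - x * cnj x / a"
      using pos by (simp add: t_def field_simps)
    also have "\<dots> = of_real (c - (norm x)\<^sup>2 / a)"
      using complex_norm_square[of x] by simp
    also have "c - (norm x)\<^sup>2 / a = 0"
      using x(2)[symmetric] pos by simp
    finally have "v - t *s e = 0"
      using herm_form_self_eq_0[OF g(2)] by simp
    then have "II e v = t *s II e e"
      using clinear_map_scale[OF II] by simp
    moreover have "t \<noteq> 0" using x pos by (simp add: t_def)
    ultimately show False using e v by (simp add: vec_eq_iff)
  qed
  define L where "L = (\<lambda>(u, v). J u + II e v)"
  have linL: "linear L"
  proof -
    have l: "linear J" "linear (II e)" using J II by (auto simp: clinear_map_def)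
    show ?thesis unfolding L_def
      by (rule linearI) (auto simp: linear_add[OF l(1)] linear_add[OF l(2)] linear_scale[OF l(1)]
          linear_scale[OF l(2)] algebra_simps)
  qed
  have injL: "inj L"
  proof (rule linear_injective_0[OF linL, THEN iffD2], intro allI impI)
    fix p assume p: "L p = 0"
    obtain u v where uv: "p = (u, v)" by fastforce
    with p have J0: "J u + II e v = 0" by (simp add: L_def)
    \<comment> \<open>Pairing with II(e,v) isolates the normal summand, since values of II are
      orthogonal to the range of J.\<close>
    have "herm_form G (II e v) (J u + II e v) = herm_form G (II e v) (II e v)"
      by (simp add: herm_form_add_right orth)
    then have IIv: "II e v = 0" using herm_form_self_eq_0[OF G(2), of "II e v"] J0 by simp
    with J0 have "J u = J 0" using clinear_map_zero[OF J(1)] by simp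
    then show "p = 0" using inj[OF IIv] injD[OF J(2)] uv by (simp add: zero_prod_def)
  qed
  have "dim (range L) = DIM((complex^'n) \<times> (complex^'n))"
    using dim_image_eq[OF linL, of UNIV] injL by simp
  moreover have "dim (range L) \<le> DIM(complex^'m)"
    by (rule dim_subset_UNIV)
  ultimately show False using dim by simp
qed

section \<open>Kaehler metrics in a chart\<close>

lemma sum_swap13:
  fixes f :: "_ \<Rightarrow> _ \<Rightarrow> _ \<Rightarrow> 'c::comm_monoid_add"
  shows "(\<Sum>a\<in>A. \<Sum>b\<in>B. \<Sum>c\<in>C. f a b c) = (\<Sum>c\<in>C. \<Sum>b\<in>B. \<Sum>a\<in>A. f a b c)"
proof -
  have "(\<Sum>a\<in>A. \<Sum>b\<in>B. \<Sum>c\<in>C. f a b c) = (\<Sum>b\<in>B. \<Sum>a\<in>A. \<Sum>c\<in>C. f a b c)"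
    by (rule sum.swap)
  also have "\<dots> = (\<Sum>b\<in>B. \<Sum>c\<in>C. \<Sum>a\<in>A. f a b c)"
    by (intro sum.cong refl sum.swap)
  also have "\<dots> = (\<Sum>c\<in>C. \<Sum>b\<in>B. \<Sum>a\<in>A. f a b c)"
    by (rule sum.swap)
  finally show ?thesis .
qed

text \<open>Slots two and four are conjugate-linear. Curvature of Y has to be evaluated on the
  vectors \<open>J z (axis a 1)\<close>, which are not coordinate vectors, hence a multilinear form
  instead of components.\<close>

definition tensor_eval ::
  "('n \<Rightarrow> 'n \<Rightarrow> 'n \<Rightarrow> 'n \<Rightarrow> complex) \<Rightarrow> complex^'n::finite \<Rightarrow> complex^'n \<Rightarrow> complex^'n \<Rightarrow> complex^'n \<Rightarrow> complex" where
  "tensor_eval T u v w y = (\<Sum>a\<in>UNIV. \<Sum>b\<in>UNIV. \<Sum>m\<in>UNIV. \<Sum>n\<in>UNIV.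
     T a b m n * (u $ a * cnj (v $ b)) * (w $ m * cnj (y $ n)))"

lemma tensor_eval_add:
  "tensor_eval (\<lambda>a b m n. T a b m n + T' a b m n) u v w y = tensor_eval T u v w y + tensor_eval T' u v w y"
  by (simp add: tensor_eval_def distrib_right sum.distrib)

lemma tensor_eval_product:
  "tensor_eval (\<lambda>a b m n. H $ a $ b * K $ m $ n) u v w y = herm_form H u v * herm_form K w y"
  unfolding tensor_eval_def herm_form_def
  by (simp only: sum_distrib_right) (simp add: sum_distrib_left ac_simps)

lemma tensor_eval_swap_hol:
  "tensor_eval (\<lambda>a b m n. T m b a n) u v w y = tensor_eval T w v u y"
  unfolding tensor_eval_def by (subst sum_swap13) (simp add: ac_simps)

lemma tensor_eval_swap_anti:
  "tensor_eval (\<lambda>a b m n. T a n m b) u v w y = tensor_eval T u y w v"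
  unfolding tensor_eval_def
  by (rule sum.cong[OF refl], rule trans[OF sum_swap13], simp add: ac_simps)

text \<open>The middle summands are product tensors with the two unbarred, respectively the two
  barred, slots exchanged; the last one is a product with its factors commuted.\<close>

lemma tensor_eval_flat:
  "tensor_eval (\<lambda>a b m n. H1 $ a $ b * g $ m $ n + H2 $ m $ b * g $ a $ n
        + H3 $ a $ n * g $ m $ b + H4 $ m $ n * g $ a $ b) u v w y
    = herm_form H1 u v * herm_form g w y + herm_form H2 w v * herm_form g u y
      + herm_form H3 u y * herm_form g w v + herm_form H4 w y * herm_form g u v"
proof -
  have "tensor_eval (\<lambda>a b m n. H2 $ m $ b * g $ a $ n) u v w y = herm_form H2 w v * herm_form g u y"
    using tensor_eval_swap_hol[of "\<lambda>a b m n. H2 $ a $ b * g $ m $ n"] tensor_eval_product by metis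
  moreover have "tensor_eval (\<lambda>a b m n. H3 $ a $ n * g $ m $ b) u v w y = herm_form H3 u y * herm_form g w v"
    using tensor_eval_swap_anti[of "\<lambda>a b m n. H3 $ a $ b * g $ m $ n"] tensor_eval_product by metis
  moreover have "tensor_eval (\<lambda>a b m n. H4 $ m $ n * g $ a $ b) u v w y = herm_form H4 w y * herm_form g u v"
    using tensor_eval_product[of g H4] by (simp add: mult.commute)
  ultimately show ?thesis
    by (simp add: tensor_eval_add tensor_eval_product)
qed

text \<open>\<open>metric_dz Y d w y\<close> is the derivative \<open>\<partial>\<^sub>w g\<close> in the direction of a (1,0)-vector
  and \<open>metric_dzbar Y d w y\<close> the one in the direction of its conjugate.\<close>

definition metric_dz ::
  "('b, 'm::finite) hermitian_structure \<Rightarrow> ('b, 'm) chart \<Rightarrow> complex^'m \<Rightarrow> complex^'m \<Rightarrow> complex^'m^'m" where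
  "metric_dz Y d w y = (\<chi> i j. \<Sum>k\<in>UNIV. w $ k * d_z k (\<lambda>x. metric Y d x $ i $ j) y)"

definition metric_dzbar ::
  "('b, 'm::finite) hermitian_structure \<Rightarrow> ('b, 'm) chart \<Rightarrow> complex^'m \<Rightarrow> complex^'m \<Rightarrow> complex^'m^'m" where
  "metric_dzbar Y d w y = (\<chi> i j. \<Sum>k\<in>UNIV. cnj (w $ k) * d_zbar k (\<lambda>x. metric Y d x $ i $ j) y)"

definition metric_dz_dzbar ::
  "('b, 'm::finite) hermitian_structure \<Rightarrow> ('b, 'm) chart \<Rightarrow> complex^'m \<Rightarrow> complex^'m \<Rightarrow> complex^'m \<Rightarrow> complex^'m^'m" where
  "metric_dz_dzbar Y d w v y = (\<chi> i j. \<Sum>l\<in>UNIV. cnj (v $ l) *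
     (\<Sum>k\<in>UNIV. w $ k * d_z k (d_zbar l (\<lambda>x. metric Y d x $ i $ j)) y))"

text \<open>The correction term of \<open>covariant_deriv\<close>; the first vector is the direction
  of differentiation, the second the value of the field.\<close>

definition christoffel_vec ::
  "('b, 'm::finite) hermitian_structure \<Rightarrow> ('b, 'm) chart \<Rightarrow> complex^'m \<Rightarrow> complex^'m \<Rightarrow> complex^'m \<Rightarrow> complex^'m" where
  "christoffel_vec Y d y v w = (\<chi> l. \<Sum>m\<in>UNIV. \<Sum>a\<in>UNIV. christoffel Y d y l m a * v $ m * w $ a)"

lemma clinear_map_christoffel_vec: "clinear_map (\<lambda>v. christoffel_vec Y d y v w)"
  unfolding clinear_map_def christoffel_vec_def
  by (auto intro!: linearI simp: vec_eq_iff algebra_simps sum.distrib sum_distrib_left scaleR_sum_right)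

lemma hermitian_chart:
  assumes "hermitian_manifold M" "c \<in> holo_charts M"
  shows "open (chart_img c)" "smooth_on (chart_img c) (metric M c)"
    "\<And>z. z \<in> chart_img c \<Longrightarrow> hermitian_matrix (metric M c z)"
    "\<And>z. z \<in> chart_img c \<Longrightarrow> positive_matrix (metric M c z)"
proof -
  show "open (chart_img c)"
    using assms(2) by (simp add: holo_charts_def is_chart_def)
  have "smooth_on (chart_img c) (metric M c) \<and>
      (\<forall>z\<in>chart_img c. hermitian_matrix (metric M c z) \<and> positive_matrix (metric M c z))"
    using assms unfolding hermitian_manifold_def by blast
  then show "smooth_on (chart_img c) (metric M c)"
    "\<And>z. z \<in> chart_img c \<Longrightarrow> hermitian_matrix (metric M c z)"
    "\<And>z. z \<in> chart_img c \<Longrightarrow> positive_matrix (metric M c z)"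
    by blast+
qed

lemma smooth_on_metric_entry:
  assumes "hermitian_manifold M" "c \<in> holo_charts M"
  shows "smooth_on (chart_img c) (\<lambda>x. metric M c x $ i $ j)"
  by (intro smooth_on_bounded_linear[OF _ bounded_linear_vec_nth] hermitian_chart[OF assms])

lemma metric_entry_has_derivative:
  assumes "hermitian_manifold M" "c \<in> holo_charts M" "z \<in> chart_img c"
  shows "((\<lambda>x. metric M c x $ i $ j) has_derivative frechet_derivative (\<lambda>x. metric M c x $ i $ j) (at z)) (at z)"
  by (rule smooth_on_has_derivative[OF smooth_on_metric_entry[OF assms(1,2)] assms(3)])

lemma smooth_on_imp_d_zbar_has_derivative:
  assumes "smooth_on S f" "z \<in> S"
  shows "(d_zbar i f has_derivative frechet_derivative (d_zbar i f) (at z)) (at z)"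
proof -
  have *: "((\<lambda>x. frechet_derivative f (at x) v) has_derivative
      frechet_derivative (\<lambda>x. frechet_derivative f (at x) v) (at z)) (at z)" for v
    by (rule smooth_on_has_derivative[OF smooth_on_frechet_derivative[OF assms(1)] assms(2)])
  have "d_zbar i f differentiable (at z)"
    unfolding d_zbar_def differentiable_def
    by (rule exI, rule bounded_linear.has_derivative[OF bounded_linear_divide,
        OF has_derivative_add[OF *[of "axis i 1"] has_derivative_mult_right[OF *[of "axis i \<i>"], of \<i>]], of 2])
  then show ?thesis
    by (simp add: frechet_derivative_works)
qed

section \<open>Metric derivatives, Christoffel symbols and curvature at one point\<close>

context
  fixes M :: "('b, 'm::finite) hermitian_structure" and c :: "('b, 'm) chart" and y :: "complex^'m"
  assumes M: "hermitian_manifold M" and c: "c \<in> holo_charts M" and y: "y \<in> chart_img c"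
begin

text \<open>The inverse metric in \<open>christoffel\<close> cancels against the metric, so lowering
  the upper index leaves the first derivatives of g. The chain of sums only reorders the
  summation.\<close>

lemma herm_form_christoffel_vec:
  "herm_form (metric M c y) (christoffel_vec M c y w u) v = herm_form (metric_dz M c w y) u v"
proof -
  let ?h = "metric M c y" and ?d = "\<lambda>m a t. d_z m (\<lambda>x. metric M c x $ a $ t) y"
  have "(\<Sum>l\<in>UNIV. christoffel M c y l m a * ?h $ l $ t) = ?d m a t" for m a t
  proof -
    have "(\<Sum>l\<in>UNIV. christoffel M c y l m a * ?h $ l $ t)
        = (\<Sum>s\<in>UNIV. ?d m a s * (\<Sum>l\<in>UNIV. g_inv ?h l s * ?h $ l $ t))"
      unfolding christoffel_def sum_distrib_right sum_distrib_left
      by (subst sum.swap) (simp add: ac_simps)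
    then show ?thesis
      by (simp add: g_inv_right[OF hermitian_chart(4)[OF M c y]] if_distrib cong: if_cong)
  qed
  note * = this[symmetric]
  have "herm_form (metric_dz M c w y) u v
      = (\<Sum>a\<in>UNIV. \<Sum>t\<in>UNIV. \<Sum>m\<in>UNIV. \<Sum>l\<in>UNIV. christoffel M c y l m a * w $ m * u $ a * ?h $ l $ t * cnj (v $ t))"
    unfolding herm_form_def metric_dz_def *
    by (simp add: sum_distrib_left sum_distrib_right ac_simps)
  also have "\<dots> = (\<Sum>a\<in>UNIV. \<Sum>l\<in>UNIV. \<Sum>m\<in>UNIV. \<Sum>t\<in>UNIV. christoffel M c y l m a * w $ m * u $ a * ?h $ l $ t * cnj (v $ t))"
    by (intro sum.cong refl sum_swap13)
  also have "\<dots> = (\<Sum>l\<in>UNIV. \<Sum>a\<in>UNIV. \<Sum>m\<in>UNIV. \<Sum>t\<in>UNIV. christoffel M c y l m a * w $ m * u $ a * ?h $ l $ t * cnj (v $ t))"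
    by (rule sum.swap)
  also have "\<dots> = (\<Sum>l\<in>UNIV. \<Sum>t\<in>UNIV. \<Sum>m\<in>UNIV. \<Sum>a\<in>UNIV. christoffel M c y l m a * w $ m * u $ a * ?h $ l $ t * cnj (v $ t))"
    by (intro sum.cong refl sum_swap13)
  also have "\<dots> = herm_form ?h (christoffel_vec M c y w u) v"
    unfolding herm_form_def christoffel_vec_def
    by (simp add: sum_distrib_left sum_distrib_right ac_simps)
  finally show ?thesis by simp
qed

lemma d_zbar_metric: "d_zbar l (\<lambda>x. metric M c x $ i $ j) y = cnj (d_z l (\<lambda>x. metric M c x $ j $ i) y)"
proof -
  have "d_zbar l (\<lambda>x. metric M c x $ i $ j) y = d_zbar l (\<lambda>x. cnj (metric M c x $ j $ i)) y"
    using hermitian_matrix_cnj[OF hermitian_chart(3)[OF M c]]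
    by (intro d_z_cong_open(2)[OF hermitian_chart(1)[OF M c] y]) simp
  then show ?thesis
    using d_zbar_cnj[OF metric_entry_has_derivative[OF M c y]] by simp
qed

text \<open>Conjugating the identity for \<open>metric_dz\<close> moves the Christoffel term to the
  conjugate-linear slot.\<close>

lemma herm_form_metric_dzbar:
  "herm_form (metric_dzbar M c w y) u v = herm_form (metric M c y) u (christoffel_vec M c y w v)"
proof -
  have "herm_form (metric_dzbar M c w y) u v = cnj (herm_form (metric_dz M c w y) v u)"
    unfolding herm_form_def metric_dz_def metric_dzbar_def d_zbar_metric
    by (subst sum.swap) (simp add: ac_simps)
  then show ?thesis
    unfolding herm_form_christoffel_vec[symmetric] herm_form_cnj[OF hermitian_chart(3)[OF M c y], symmetric] .
qed

text \<open>In the quadratic part of the curvature, the inverse metric and the unbarred derivative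
  combine to a Christoffel vector; contracting it with the barred derivative of g produces the
  second one.\<close>

lemma curvature_tensor_eval:
  "tensor_eval (curvature M c y) u v w x
    = - herm_form (metric_dz_dzbar M c w x y) u v
      + herm_form (metric M c y) (christoffel_vec M c y w u) (christoffel_vec M c y x v)"
proof -
  let ?h = "metric M c y" and ?d = "\<lambda>m a t. d_z m (\<lambda>x. metric M c x $ a $ t) y"
    and ?e = "\<lambda>m a t. d_zbar m (\<lambda>x. metric M c x $ a $ t) y"
  have 1: "tensor_eval (\<lambda>a b m n. - d_z m (d_zbar n (\<lambda>x. metric M c x $ a $ b)) y) u v w x
      = - herm_form (metric_dz_dzbar M c w x y) u v"
  proof -
    have "herm_form (metric_dz_dzbar M c w x y) u v = (\<Sum>a\<in>UNIV. \<Sum>b\<in>UNIV. \<Sum>n\<in>UNIV. \<Sum>m\<in>UNIV.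
        d_z m (d_zbar n (\<lambda>x. metric M c x $ a $ b)) y * (u $ a * cnj (v $ b)) * (w $ m * cnj (x $ n)))"
      unfolding herm_form_def metric_dz_dzbar_def
      by (simp add: sum_distrib_left sum_distrib_right ac_simps)
    also have "\<dots> = (\<Sum>a\<in>UNIV. \<Sum>b\<in>UNIV. \<Sum>m\<in>UNIV. \<Sum>n\<in>UNIV.
        d_z m (d_zbar n (\<lambda>x. metric M c x $ a $ b)) y * (u $ a * cnj (v $ b)) * (w $ m * cnj (x $ n)))"
      by (intro sum.cong refl sum.swap)
    finally show ?thesis
      by (simp add: tensor_eval_def sum_negf)
  qed
  have "herm_form ?h (christoffel_vec M c y w u) (christoffel_vec M c y x v)
      = herm_form (metric_dzbar M c x y) (christoffel_vec M c y w u) v"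
    by (rule herm_form_metric_dzbar[symmetric])
  also have "\<dots> = (\<Sum>s\<in>UNIV. (\<Sum>m\<in>UNIV. \<Sum>a\<in>UNIV. \<Sum>t\<in>UNIV. g_inv ?h s t * ?d m a t * (w $ m * u $ a))
       * (\<Sum>b\<in>UNIV. \<Sum>n\<in>UNIV. ?e n s b * (cnj (x $ n) * cnj (v $ b))))"
  proof -
    have "herm_form (metric_dzbar M c x y) (christoffel_vec M c y w u) v = (\<Sum>s\<in>UNIV.
        christoffel_vec M c y w u $ s * (\<Sum>b\<in>UNIV. metric_dzbar M c x y $ s $ b * cnj (v $ b)))"
      by (simp add: herm_form_def sum_distrib_left ac_simps)
    also have "\<dots> = (\<Sum>s\<in>UNIV. (\<Sum>m\<in>UNIV. \<Sum>a\<in>UNIV. \<Sum>t\<in>UNIV. g_inv ?h s t * ?d m a t * (w $ m * u $ a))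
       * (\<Sum>b\<in>UNIV. \<Sum>n\<in>UNIV. ?e n s b * (cnj (x $ n) * cnj (v $ b))))"
      by (intro sum.cong refl arg_cong2[of _ _ _ _ "(*)"])
        (simp_all add: metric_dzbar_def christoffel_vec_def christoffel_def sum_distrib_left sum_distrib_right ac_simps)
    finally show ?thesis .
  qed
  also have "\<dots> = (\<Sum>s\<in>UNIV. (\<Sum>t\<in>UNIV. \<Sum>a\<in>UNIV. \<Sum>m\<in>UNIV. g_inv ?h s t * ?d m a t * (w $ m * u $ a))
       * (\<Sum>b\<in>UNIV. \<Sum>n\<in>UNIV. ?e n s b * (cnj (x $ n) * cnj (v $ b))))"
    by (subst sum_swap13) (rule refl)
  also have "\<dots> = (\<Sum>s\<in>UNIV. \<Sum>t\<in>UNIV. \<Sum>a\<in>UNIV. \<Sum>m\<in>UNIV. \<Sum>b\<in>UNIV. \<Sum>n\<in>UNIV.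
       g_inv ?h s t * ?d m a t * ?e n s b * (u $ a * cnj (v $ b)) * (w $ m * cnj (x $ n)))"
    by (simp only: sum_distrib_right, simp only: sum_distrib_left, simp add: ac_simps)
  also have "\<dots> = (\<Sum>s\<in>UNIV. \<Sum>t\<in>UNIV. tensor_eval (\<lambda>a b m n. g_inv ?h s t * ?d m a t * ?e n s b) u v w x)"
    unfolding tensor_eval_def by (intro sum.cong refl sum.swap)
  also have "\<dots> = tensor_eval (\<lambda>a b m n. \<Sum>s\<in>UNIV. \<Sum>t\<in>UNIV. g_inv ?h s t * ?d m a t * ?e n s b) u v w x"
  proof -
    have sm: "(\<Sum>s\<in>UNIV. tensor_eval (T s) u v w x) = tensor_eval (\<lambda>a b m n. \<Sum>s\<in>UNIV. T s a b m n) u v w x"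
      for T :: "'m \<Rightarrow> 'm \<Rightarrow> 'm \<Rightarrow> 'm \<Rightarrow> 'm \<Rightarrow> complex"
    proof -
      have "(\<Sum>s\<in>I. tensor_eval (T s) u v w x) = tensor_eval (\<lambda>a b m n. \<Sum>s\<in>I. T s a b m n) u v w x" if "finite I" for I
        using that by induction (simp_all add: tensor_eval_add, simp add: tensor_eval_def)
      then show ?thesis by simp
    qed
    show ?thesis unfolding sm ..
  qed
  finally show ?thesis
    unfolding curvature_def Let_def tensor_eval_add 1 by simp
qed

end

text \<open>Closedness is a real identity in three real vectors. Its instances with each of u, v, w
  possibly multiplied by \<i> recover the (2,1)-part of the exterior derivative, whose vanishing is
  the asserted symmetry. Hermitian symmetry of the derivative of g relates the remaining
  terms.\<close>

lemma kaehler_d_z_symmetric: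
  assumes M: "kaehler_manifold M" and c: "c \<in> holo_charts M" and y: "y \<in> chart_img c"
  shows "d_z m (\<lambda>x. metric M c x $ a $ t) y = d_z a (\<lambda>x. metric M c x $ m $ t) y"
proof -
  have hM: "hermitian_manifold M" using M by (simp add: kaehler_manifold_def)
  define T where "T = frechet_derivative (metric M c) (at y)"
  have T: "(metric M c has_derivative T) (at y)"
    unfolding T_def by (rule smooth_on_has_derivative[OF hermitian_chart(2)[OF hM c] y])
  define \<tau> where "\<tau> = (\<lambda>u v w. herm_form (T u) v w)"
  have te: "((\<lambda>x. metric M c x $ i $ j) has_derivative (\<lambda>t. T t $ i $ j)) (at y)" for i j
    by (intro has_derivative_vec_nth T)
  have "((\<lambda>x. kaehler_form (metric M c x) v w) has_derivative (\<lambda>u. - Im (\<tau> u v w))) (at y)" for v w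
  proof -
    have "((\<lambda>x. herm_form (metric M c x) v w) has_derivative (\<lambda>u. \<tau> u v w)) (at y)"
      using has_derivative_herm_form[OF te has_derivative_const has_derivative_const, of v w]
      by (simp add: \<tau>_def)
    from bounded_linear.has_derivative[OF bounded_linear_Im this]
    show ?thesis unfolding kaehler_form_def by (rule has_derivative_minus)
  qed
  then have fk: "frechet_derivative (\<lambda>x. kaehler_form (metric M c x) v w) (at y) = (\<lambda>u. - Im (\<tau> u v w))" for v w
    by (rule frechet_derivative_eqI)
  have closed: "- Im (\<tau> u v w) - - Im (\<tau> v u w) + - Im (\<tau> w u v) = 0" for u v w
    using M[unfolded kaehler_manifold_def, THEN conjunct2, rule_format, OF c y, of v w u]
    by (simp only: fk)
  have herm: "\<tau> u w v = cnj (\<tau> u v w)" for u v w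
  proof -
    have "T u $ i $ j = cnj (T u $ j $ i)" for i j
    proof -
      have "((\<lambda>x. metric M c x $ i $ j) has_derivative (\<lambda>t. cnj (T t $ j $ i))) (at y)"
        by (rule has_derivative_transform_within_open[OF has_derivative_cnj_comp[OF te] hermitian_chart(1)[OF hM c] y])
          (simp add: hermitian_matrix_cnj[OF hermitian_chart(3)[OF hM c]])
      then show ?thesis using te has_derivative_unique by metis
    qed
    then have "hermitian_matrix (T u)" unfolding hermitian_matrix_def by blast
    then show ?thesis unfolding \<tau>_def by (rule herm_form_cnj)
  qed
  have sc: "\<tau> u (\<i> *s v) w = \<i> * \<tau> u v w" "\<tau> u v (\<i> *s w) = - \<i> * \<tau> u v w" for u v w
    by (simp_all add: \<tau>_def herm_form_scale_left herm_form_scale_right)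
  (* the part of the closedness condition that is complex linear in u and v *)
  have "\<tau> u v w - \<i> * \<tau> (\<i> *s u) v w = \<tau> v u w - \<i> * \<tau> (\<i> *s v) u w" for u v w
  proof -
    note closed[of u v w] closed[of "\<i> *s u" v w] closed[of u "\<i> *s v" w] closed[of "\<i> *s u" "\<i> *s v" w]
      closed[of u v "\<i> *s w"] closed[of "\<i> *s u" v "\<i> *s w"] closed[of u "\<i> *s v" "\<i> *s w"]
      closed[of "\<i> *s u" "\<i> *s v" "\<i> *s w"]
    note this[unfolded sc, simplified]
    then show ?thesis
      unfolding complex_eq_iff by simp
  qed
  from this[of "axis m 1" "axis a 1" "axis t 1"]
  have "T (axis m 1) $ a $ t - \<i> * T (axis m \<i>) $ a $ t = T (axis a 1) $ m $ t - \<i> * T (axis a \<i>) $ m $ t"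
    unfolding \<tau>_def herm_form_axis by (simp add: axis_def vector_scalar_mult_def if_distrib cong: if_cong)
  then show ?thesis
    unfolding d_z_eqI[OF te] by simp
qed

text \<open>The Chern connection of a Kaehler metric is torsion-free.\<close>

lemma kaehler_christoffel_vec_symmetric:
  assumes "kaehler_manifold M" "c \<in> holo_charts M" "y \<in> chart_img c"
  shows "christoffel_vec M c y u v = christoffel_vec M c y v u"
proof -
  have "christoffel M c y l m a = christoffel M c y l a m" for l m a
    unfolding christoffel_def using kaehler_d_z_symmetric[OF assms] by simp
  then show ?thesis
    unfolding christoffel_vec_def vec_eq_iff
    by (auto simp: ac_simps intro: trans[OF sum.swap])
qed

section \<open>The Gauss equation\<close>

lemma clinear_map_plus: "clinear_map f \<Longrightarrow> clinear_map g \<Longrightarrow> clinear_map (\<lambda>v. f v + g v)"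
  unfolding clinear_map_def by (auto intro: linear_compose_add simp: vec.scale_right_distrib)

lemma clinear_map_compose: "clinear_map f \<Longrightarrow> clinear_map g \<Longrightarrow> clinear_map (\<lambda>v. f (g v))"
  unfolding clinear_map_def using linear_compose[of g f] by (auto simp: o_def)

lemma herm_form_axis_right: "herm_form G u (axis b 1) = (\<Sum>a\<in>UNIV. G $ a $ b * u $ a)"
  unfolding herm_form_def
  by (simp add: axis_def if_distrib[where f = cnj] mult_delta_right cong: if_cong)

lemma pseudo_conformally_flatE:
  assumes "pseudo_conformally_flat M T" and c: "c \<in> holo_charts M" and z: "z \<in> chart_img c"
  obtains H1 H2 H3 H4 where "hermitian_matrix H1" "hermitian_matrix H2" "hermitian_matrix H3" "hermitian_matrix H4"
    "T c z = (\<lambda>a b m n. H1 $ a $ b * metric M c z $ m $ n + H2 $ m $ b * metric M c z $ a $ n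
       + H3 $ a $ n * metric M c z $ m $ b + H4 $ m $ n * metric M c z $ a $ b)"
  using assms(1)[unfolded pseudo_conformally_flat_def Let_def, THEN bspec, OF c]
proof (elim exE conjE)
  fix H1 H2 H3 H4
  assume H: "\<forall>H\<in>{H1, H2, H3, H4}. smooth_on (chart_img c) H \<and> (\<forall>z\<in>chart_img c. hermitian_matrix (H z))"
    and T: "\<forall>z\<in>chart_img c. \<forall>a b m n. T c z a b m n = H1 z $ a $ b * metric M c z $ m $ n
       + H2 z $ m $ b * metric M c z $ a $ n + H3 z $ a $ n * metric M c z $ m $ b
       + H4 z $ m $ n * metric M c z $ a $ b"
  show thesis
  proof (rule that)
    show "hermitian_matrix (H1 z)" "hermitian_matrix (H2 z)" "hermitian_matrix (H3 z)" "hermitian_matrix (H4 z)"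
      using H z by simp_all
    show "T c z = (\<lambda>a b m n. H1 z $ a $ b * metric M c z $ m $ n + H2 z $ m $ b * metric M c z $ a $ n
       + H3 z $ a $ n * metric M c z $ m $ b + H4 z $ m $ n * metric M c z $ a $ b)"
      using bspec[OF T z] by (intro ext) simp
  qed
qed

text \<open>The coordinate picture: F is f read in the charts c and d. As k is the same at all
  points of S, differentiating the conformality identity produces no derivative of the
  factor.\<close>

locale conformal_local_map =
  fixes X :: "('a, 'n::finite) hermitian_structure" and Y :: "('b, 'm::finite) hermitian_structure"
    and c :: "('a, 'n) chart" and d :: "('b, 'm) chart"
    and S :: "(complex^'n) set" and F :: "complex^'n \<Rightarrow> complex^'m" and k :: real
  assumes X: "hermitian_manifold X" and Y: "kaehler_manifold Y"
    and c: "c \<in> holo_charts X" and d: "d \<in> holo_charts Y"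
    and S: "open S" "S \<subseteq> chart_img c" and F: "holo_on S F" and FS: "F ` S \<subseteq> chart_img d"
    and k: "k > 0"
    and conformal: "\<And>z u v. z \<in> S \<Longrightarrow>
      herm_form (metric Y d (F z)) (frechet_derivative F (at z) u) (frechet_derivative F (at z) v)
      = complex_of_real k * herm_form (metric X c z) u v"
begin

definition J :: "complex^'n \<Rightarrow> complex^'n \<Rightarrow> complex^'m" where
  "J z = frechet_derivative F (at z)"

definition J' :: "complex^'n \<Rightarrow> complex^'n \<Rightarrow> complex^'n \<Rightarrow> complex^'m" where
  "J' z u v = frechet_derivative (\<lambda>x. J x u) (at z) v"

text \<open>The ambient covariant derivative, in the direction v, of the field J u along F. Its
  normal part is the second fundamental form.\<close>

definition Jcov :: "complex^'n \<Rightarrow> complex^'n \<Rightarrow> complex^'n \<Rightarrow> complex^'m" where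
  "Jcov z u v = J' z u v + christoffel_vec Y d (F z) (J z v) (J z u)"

lemma hY: "hermitian_manifold Y"
  using Y by (simp add: kaehler_manifold_def)

lemma Fz: "z \<in> S \<Longrightarrow> F z \<in> chart_img d" and zc: "z \<in> S \<Longrightarrow> z \<in> chart_img c"
  using FS S by auto

lemma G: "z \<in> S \<Longrightarrow> hermitian_matrix (metric Y d (F z))" "z \<in> S \<Longrightarrow> positive_matrix (metric Y d (F z))"
  and g: "z \<in> S \<Longrightarrow> hermitian_matrix (metric X c z)" "z \<in> S \<Longrightarrow> positive_matrix (metric X c z)"
  using hermitian_chart[OF hY d] hermitian_chart[OF X c] Fz zc by auto

lemma F_has_derivative: "z \<in> S \<Longrightarrow> (F has_derivative J z) (at z)"
  unfolding J_def using F by (intro smooth_on_has_derivative) (auto simp: holo_on_def)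

lemma clinear_J: "z \<in> S \<Longrightarrow> clinear_map (J z)"
  unfolding J_def by (rule holo_on_clinear[OF F])

lemma holo_J: "holo_on S (\<lambda>x. J x u)"
  unfolding J_def by (rule holo_on_frechet_derivative[OF S(1) F])

lemma J_has_derivative: "z \<in> S \<Longrightarrow> ((\<lambda>x. J x u) has_derivative J' z u) (at z)"
  unfolding J'_def using holo_J by (intro smooth_on_has_derivative) (auto simp: holo_on_def)

lemma clinear_J': "z \<in> S \<Longrightarrow> clinear_map (J' z u)"
  unfolding J'_def by (rule holo_on_clinear[OF holo_J])

lemma holo_J': "holo_on S (\<lambda>x. J' x u v)"
  unfolding J'_def by (rule holo_on_frechet_derivative[OF S(1) holo_J])

lemma J'_sym: "z \<in> S \<Longrightarrow> J' z u v = J' z v u"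
  unfolding J'_def J_def using F by (intro second_derivative_symmetric[OF S(1)]) (auto simp: holo_on_def)

lemma J'_has_derivative: "z \<in> S \<Longrightarrow> ((\<lambda>x. J' x u v) has_derivative frechet_derivative (\<lambda>x. J' x u v) (at z)) (at z)"
  using holo_J' by (intro smooth_on_has_derivative) (auto simp: holo_on_def)

lemma clinear_J'': "z \<in> S \<Longrightarrow> clinear_map (frechet_derivative (\<lambda>x. J' x u v) (at z))"
  by (rule holo_on_clinear[OF holo_J'])

lemma conf: "z \<in> S \<Longrightarrow> herm_form (metric Y d (F z)) (J z u) (J z v) = complex_of_real k * herm_form (metric X c z) u v"
  unfolding J_def by (rule conformal)

lemma inj_J: "z \<in> S \<Longrightarrow> inj (J z)"
proof (rule linear_injective_0[THEN iffD2], use clinear_J in \<open>simp add: clinear_map_def\<close>, intro allI impI)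
  fix u assume z: "z \<in> S" and "J z u = 0"
  then have "complex_of_real k * herm_form (metric X c z) u u = 0"
    using conf[OF z, of u u] by simp
  then show "u = 0" using k herm_form_self_eq_0[OF g(2)[OF z]] by simp
qed

lemma Jcov_sym: "z \<in> S \<Longrightarrow> Jcov z u v = Jcov z v u"
  unfolding Jcov_def using J'_sym kaehler_christoffel_vec_symmetric[OF Y d Fz] by simp

lemma clinear_Jcov: "z \<in> S \<Longrightarrow> clinear_map (Jcov z u)"
  unfolding Jcov_def
  by (intro clinear_map_plus clinear_J' clinear_map_compose[OF clinear_map_christoffel_vec] clinear_J)

lemma metric_F_has_derivative:
  assumes z: "z \<in> S"
  shows "((\<lambda>x. metric Y d (F x) $ i $ j) has_derivative
    (\<lambda>t. frechet_derivative (\<lambda>x. metric Y d x $ i $ j) (at (F z)) (J z t))) (at z)"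
  by (rule has_derivative_compose[OF F_has_derivative[OF z] metric_entry_has_derivative[OF hY d Fz[OF z]]])

lemma d_z_metric_F:
  assumes z: "z \<in> S"
  shows "(\<chi> i j. d_z m (\<lambda>x. metric Y d (F x) $ i $ j) z) = metric_dz Y d (J z (axis m 1)) (F z)"
    and "(\<chi> i j. d_zbar m (\<lambda>x. metric Y d (F x) $ i $ j) z) = metric_dzbar Y d (J z (axis m 1)) (F z)"
  unfolding metric_dz_def metric_dzbar_def
    d_z_compose[OF metric_entry_has_derivative[OF hY d Fz[OF z]] F_has_derivative[OF z] clinear_J[OF z]]
    d_zbar_compose[OF metric_entry_has_derivative[OF hY d Fz[OF z]] F_has_derivative[OF z] clinear_J[OF z]]
  by simp_all

lemma metric_X_eq:
  assumes "z \<in> S"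
  shows "complex_of_real k * metric X c z $ a $ b = herm_form (metric Y d (F z)) (J z (axis a 1)) (J z (axis b 1))"
  using conf[OF assms, of "axis a 1" "axis b 1"] by (simp add: herm_form_axis)

text \<open>Differentiating the conformality identity by \<open>d_z\<close> hits the ambient metric
  and the first slot only; the Christoffel identity merges both terms into
  \<open>Jcov\<close>.\<close>

lemma d_z_metric_X:
  assumes z: "z \<in> S"
  shows "complex_of_real k * d_z m (\<lambda>x. metric X c x $ a $ b) z
    = herm_form (metric Y d (F z)) (Jcov z (axis a 1) (axis m 1)) (J z (axis b 1))"
proof -
  have "complex_of_real k * d_z m (\<lambda>x. metric X c x $ a $ b) z = d_z m (\<lambda>x. complex_of_real k * metric X c x $ a $ b) z"
    by (rule d_z_cmult[OF metric_entry_has_derivative[OF X c zc[OF z]], symmetric])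
  also have "\<dots> = d_z m (\<lambda>x. herm_form (metric Y d (F x)) (J x (axis a 1)) (J x (axis b 1))) z"
    by (rule d_z_cong_open(1)[OF S(1) z metric_X_eq])
  also have "\<dots> = herm_form (metric_dz Y d (J z (axis m 1)) (F z)) (J z (axis a 1)) (J z (axis b 1))
      + herm_form (metric Y d (F z)) (J' z (axis a 1) (axis m 1)) (J z (axis b 1))"
    unfolding d_z_herm_form[OF metric_F_has_derivative[OF z] J_has_derivative[OF z] J_has_derivative[OF z]
        clinear_J'[OF z] clinear_J'[OF z]] d_z_metric_F[OF z] ..
  finally show ?thesis
    unfolding Jcov_def herm_form_add_left herm_form_christoffel_vec[OF hY d Fz[OF z]] by simp
qed

text \<open>Left in unmerged form because it will be differentiated once more: writing it with
  \<open>Jcov\<close> would then require derivatives of Christoffel symbols, hence of the inverse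
  metric.\<close>

lemma d_zbar_metric_X:
  assumes z: "z \<in> S"
  shows "complex_of_real k * d_zbar n (\<lambda>x. metric X c x $ a $ b) z
    = herm_form (metric_dzbar Y d (J z (axis n 1)) (F z)) (J z (axis a 1)) (J z (axis b 1))
      + herm_form (metric Y d (F z)) (J z (axis a 1)) (J' z (axis b 1) (axis n 1))"
proof -
  have "complex_of_real k * d_zbar n (\<lambda>x. metric X c x $ a $ b) z = d_zbar n (\<lambda>x. complex_of_real k * metric X c x $ a $ b) z"
    by (rule d_zbar_cmult[OF metric_entry_has_derivative[OF X c zc[OF z]], symmetric])
  also have "\<dots> = d_zbar n (\<lambda>x. herm_form (metric Y d (F x)) (J x (axis a 1)) (J x (axis b 1))) z"
    by (rule d_z_cong_open(2)[OF S(1) z metric_X_eq])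
  also have "\<dots> = herm_form (metric_dzbar Y d (J z (axis n 1)) (F z)) (J z (axis a 1)) (J z (axis b 1))
      + herm_form (metric Y d (F z)) (J z (axis a 1)) (J' z (axis b 1) (axis n 1))"
    unfolding d_zbar_herm_form[OF metric_F_has_derivative[OF z] J_has_derivative[OF z] J_has_derivative[OF z]
        clinear_J'[OF z] clinear_J'[OF z]] d_z_metric_F[OF z] ..
  finally show ?thesis .
qed

lemma d_zbar_metric_X':
  assumes z: "z \<in> S"
  shows "complex_of_real k * d_zbar n (\<lambda>x. metric X c x $ a $ b) z
    = herm_form (metric Y d (F z)) (J z (axis a 1)) (Jcov z (axis b 1) (axis n 1))"
  unfolding d_zbar_metric_X[OF z] Jcov_def herm_form_add_right herm_form_metric_dzbar[OF hY d Fz[OF z]]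
  by simp

text \<open>The barred direction enters through conjugates of J, which are constant for
  \<open>d_z\<close>; the chain rule for F then leaves the mixed second derivative alone.\<close>

lemma metric_dzbar_F:
  assumes z: "z \<in> S"
  shows "((\<lambda>x. metric_dzbar Y d (J x u) (F x) $ i $ j) has_derivative
      frechet_derivative (\<lambda>x. metric_dzbar Y d (J x u) (F x) $ i $ j) (at z)) (at z)"
    and "(\<chi> i j. d_z m (\<lambda>x. metric_dzbar Y d (J x u) (F x) $ i $ j) z)
      = metric_dz_dzbar Y d (J z (axis m 1)) (J z u) (F z)"
proof -
  let ?e = "\<lambda>i j l. d_zbar l (\<lambda>x. metric Y d x $ i $ j)"
  have D: "(?e i j l has_derivative frechet_derivative (?e i j l) (at (F z))) (at (F z))" for i j l
    by (rule smooth_on_imp_d_zbar_has_derivative[OF smooth_on_metric_entry[OF hY d] Fz[OF z]])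
  have DF: "((\<lambda>x. ?e i j l (F x)) has_derivative (\<lambda>t. frechet_derivative (?e i j l) (at (F z)) (J z t))) (at z)" for i j l
    by (rule has_derivative_compose[OF F_has_derivative[OF z] D])
  have Jc: "((\<lambda>x. cnj (J x u $ l)) has_derivative (\<lambda>t. cnj (J' z u t $ l))) (at z)" for l
    by (intro has_derivative_cnj_comp has_derivative_vec_nth J_has_derivative z)
  note P = has_derivative_mult[OF Jc DF]
  have eq: "metric_dzbar Y d (J x u) (F x) $ i $ j = (\<Sum>l\<in>UNIV. cnj (J x u $ l) * ?e i j l (F x))" for x i j
    by (simp add: metric_dzbar_def)
  have "((\<lambda>x. \<Sum>l\<in>UNIV. cnj (J x u $ l) * ?e i j l (F x)) differentiable (at z))"
    unfolding differentiable_def by (rule exI, rule has_derivative_sum[OF P])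
  then show "((\<lambda>x. metric_dzbar Y d (J x u) (F x) $ i $ j) has_derivative
      frechet_derivative (\<lambda>x. metric_dzbar Y d (J x u) (F x) $ i $ j) (at z)) (at z)"
    unfolding eq by (simp only: frechet_derivative_works)
  show "(\<chi> i j. d_z m (\<lambda>x. metric_dzbar Y d (J x u) (F x) $ i $ j) z)
      = metric_dz_dzbar Y d (J z (axis m 1)) (J z u) (F z)"
    unfolding eq d_z_sum[OF P] d_z_antiholo_mult[OF J_has_derivative[OF z] clinear_J'[OF z] DF]
      d_z_compose[OF D F_has_derivative[OF z] clinear_J[OF z]] metric_dz_dzbar_def ..
qed

text \<open>The product rule yields four terms. Trading the mixed derivative of g for curvature
  leaves a pairing of two Christoffel vectors, which completes the other three to the pairing of two
  \<open>Jcov\<close>.\<close>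

lemma d_z_d_zbar_metric_X:
  assumes z: "z \<in> S"
  shows "complex_of_real k * d_z m (d_zbar n (\<lambda>x. metric X c x $ a $ b)) z
    = - tensor_eval (curvature Y d (F z)) (J z (axis a 1)) (J z (axis b 1)) (J z (axis m 1)) (J z (axis n 1))
      + herm_form (metric Y d (F z)) (Jcov z (axis a 1) (axis m 1)) (Jcov z (axis b 1) (axis n 1))"
proof -
  let ?a = "axis a 1" and ?b = "axis b 1" and ?m = "axis m 1" and ?n = "axis n 1"
  note DM = metric_dzbar_F(1)[OF z, of ?n]
  note D = smooth_on_imp_d_zbar_has_derivative[OF smooth_on_metric_entry[OF X c] zc[OF z]]
  have "complex_of_real k * d_z m (d_zbar n (\<lambda>x. metric X c x $ a $ b)) z
      = d_z m (\<lambda>x. complex_of_real k * d_zbar n (\<lambda>x. metric X c x $ a $ b) x) z"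
    by (rule d_z_cmult[OF D, symmetric])
  also have "\<dots> = d_z m (\<lambda>x. herm_form (metric_dzbar Y d (J x ?n) (F x)) (J x ?a) (J x ?b)
      + herm_form (metric Y d (F x)) (J x ?a) (J' x ?b ?n)) z"
    by (rule d_z_cong_open(1)[OF S(1) z d_zbar_metric_X])
  also have "\<dots> = d_z m (\<lambda>x. herm_form (metric_dzbar Y d (J x ?n) (F x)) (J x ?a) (J x ?b)) z
      + d_z m (\<lambda>x. herm_form (metric Y d (F x)) (J x ?a) (J' x ?b ?n)) z"
    by (rule d_z_add[OF has_derivative_herm_form[OF DM J_has_derivative[OF z] J_has_derivative[OF z]]
        has_derivative_herm_form[OF metric_F_has_derivative[OF z] J_has_derivative[OF z] J'_has_derivative[OF z]]])
  also have "\<dots> = herm_form (metric_dz_dzbar Y d (J z ?m) (J z ?n) (F z)) (J z ?a) (J z ?b)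
      + herm_form (metric_dzbar Y d (J z ?n) (F z)) (J' z ?a ?m) (J z ?b)
      + (herm_form (metric_dz Y d (J z ?m) (F z)) (J z ?a) (J' z ?b ?n)
      + herm_form (metric Y d (F z)) (J' z ?a ?m) (J' z ?b ?n))"
    unfolding d_z_herm_form[OF DM J_has_derivative[OF z] J_has_derivative[OF z] clinear_J'[OF z] clinear_J'[OF z]]
      d_z_herm_form[OF metric_F_has_derivative[OF z] J_has_derivative[OF z] J'_has_derivative[OF z]
        clinear_J'[OF z] clinear_J''[OF z]] d_z_metric_F[OF z] metric_dzbar_F(2)[OF z] ..
  finally show ?thesis
    unfolding Jcov_def herm_form_add_left herm_form_add_right curvature_tensor_eval[OF hY d Fz[OF z]]
      herm_form_metric_dzbar[OF hY d Fz[OF z]] herm_form_christoffel_vec[OF hY d Fz[OF z], symmetric]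
    by simp
qed

text \<open>The tangential part of \<open>Jcov z a m\<close>, so that \<open>sff\<close> is the second fundamental form.\<close>

definition tang :: "complex^'n \<Rightarrow> 'n \<Rightarrow> 'n \<Rightarrow> complex^'n" where
  "tang z a m = (\<chi> s. \<Sum>t\<in>UNIV. g_inv (metric X c z) s t *
     (herm_form (metric Y d (F z)) (Jcov z (axis a 1) (axis m 1)) (J z (axis t 1)) / complex_of_real k))"

definition sff :: "complex^'n \<Rightarrow> 'n \<Rightarrow> 'n \<Rightarrow> complex^'m" where
  "sff z a m = Jcov z (axis a 1) (axis m 1) - J z (tang z a m)"

text \<open>J pulls the metric of Y back to k g, so the inverse of g together with the division by k
  in \<open>tang\<close> solves the linear system for the tangential component.\<close>

lemma sff_orthogonal_axis:
  assumes z: "z \<in> S"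
  shows "herm_form (metric Y d (F z)) (sff z a m) (J z (axis b 1)) = 0"
proof -
  let ?x = "\<lambda>t. herm_form (metric Y d (F z)) (Jcov z (axis a 1) (axis m 1)) (J z (axis t 1))"
  have "herm_form (metric Y d (F z)) (J z (tang z a m)) (J z (axis b 1))
      = complex_of_real k * (\<Sum>s\<in>UNIV. tang z a m $ s * metric X c z $ s $ b)"
    unfolding conf[OF z] herm_form_axis_right by (simp add: mult.commute)
  also have "\<dots> = (\<Sum>s\<in>UNIV. \<Sum>t\<in>UNIV. ?x t * (g_inv (metric X c z) s t * metric X c z $ s $ b))"
    using k by (simp add: tang_def sum_distrib_left sum_distrib_right field_simps)
  also have "\<dots> = (\<Sum>t\<in>UNIV. ?x t * (\<Sum>s\<in>UNIV. g_inv (metric X c z) s t * metric X c z $ s $ b))"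
    by (subst sum.swap) (simp add: sum_distrib_left)
  also have "\<dots> = ?x b"
    unfolding g_inv_right(1)[OF g(2)[OF z]] by (simp add: if_distrib cong: if_cong)
  finally show ?thesis
    by (simp add: sff_def herm_form_diff_left)
qed

lemma sff_orthogonal:
  assumes z: "z \<in> S"
  shows "herm_form (metric Y d (F z)) (sff z a m) (J z u) = 0"
  unfolding clinear_map_expand[OF clinear_J[OF z], of u] herm_form_sum_right herm_form_scale_right
    sff_orthogonal_axis[OF z] by simp

text \<open>By \<open>d_z_metric_X\<close>, \<open>tang z a m\<close> consists of Christoffel
  symbols of X. The quadratic part of the curvature of X is thus the pairing of J
  \<open>tang\<close> with \<open>Jcov\<close>, and the difference of the curvatures retains only
  the normal parts.\<close>

lemma gauss_equation:
  assumes z: "z \<in> S"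
  shows "herm_form (metric Y d (F z)) (sff z a m) (sff z b n)
    = tensor_eval (curvature Y d (F z)) (J z (axis a 1)) (J z (axis b 1)) (J z (axis m 1)) (J z (axis n 1))
      - complex_of_real k * curvature X c z a b m n"
proof -
  let ?h = "herm_form (metric Y d (F z))"
  let ?D = "\<lambda>a m. Jcov z (axis a 1) (axis m 1)"
  \<comment> \<open>Both first derivatives need a factor k to be expressed through Y, but only one
    is present; the other is divided out and absorbed into \<open>tang\<close>.\<close>
  have "complex_of_real k * (\<Sum>s\<in>UNIV. \<Sum>t\<in>UNIV. g_inv (metric X c z) s t
        * d_z m (\<lambda>x. metric X c x $ a $ t) z * d_zbar n (\<lambda>x. metric X c x $ s $ b) z)
      = (\<Sum>s\<in>UNIV. \<Sum>t\<in>UNIV. g_inv (metric X c z) s t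
        * ((complex_of_real k * d_z m (\<lambda>x. metric X c x $ a $ t) z) / complex_of_real k)
        * (complex_of_real k * d_zbar n (\<lambda>x. metric X c x $ s $ b) z))"
    using k by (simp add: sum_distrib_left ac_simps)
  also have "\<dots> = (\<Sum>s\<in>UNIV. tang z a m $ s * ?h (J z (axis s 1)) (?D b n))"
    unfolding d_z_metric_X[OF z] d_zbar_metric_X'[OF z] tang_def
    by (simp add: sum_distrib_right)
  also have "\<dots> = ?h (J z (tang z a m)) (?D b n)"
    unfolding clinear_map_expand[OF clinear_J[OF z], of "tang z a m"] herm_form_sum_left herm_form_scale_left ..
  finally have "complex_of_real k * curvature X c z a b m n
      = tensor_eval (curvature Y d (F z)) (J z (axis a 1)) (J z (axis b 1)) (J z (axis m 1)) (J z (axis n 1))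
       - ?h (?D a m) (?D b n) + ?h (J z (tang z a m)) (?D b n)"
    unfolding curvature_def[of X] Let_def distrib_left minus_mult_right[symmetric] d_z_d_zbar_metric_X[OF z]
    by simp
  \<comment> \<open>A normal first argument does not see the tangential part of the second
    one.\<close>
  moreover have "?h (sff z a m) (sff z b n) = ?h (sff z a m) (?D b n)"
    unfolding sff_def[of z b n] herm_form_diff_right sff_orthogonal[OF z] by simp
  ultimately show ?thesis
    unfolding sff_def[of z a m] herm_form_diff_left by simp
qed

text \<open>Flatness of both curvatures puts the Gauss equation into the form treated by
  \<open>flat_second_fundamental_form_zero\<close>; what survives of \<open>Jcov\<close> is its
  tangential part.\<close>

lemma Jcov_tangential:
  assumes z: "z \<in> S" and dim: "CARD('m) < 2 * CARD('n)"
    and flatX: "pseudo_conformally_flat X (curvature X)" and flatY: "pseudo_conformally_flat Y (curvature Y)"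
  shows "Jcov z u v \<in> range (J z)"
proof -
  let ?h = "herm_form (metric Y d (F z))"
  obtain H1 H2 H3 H4 where H: "hermitian_matrix H1" "hermitian_matrix H2" "hermitian_matrix H3" "hermitian_matrix H4"
    and RX: "curvature X c z = (\<lambda>a b m n. H1 $ a $ b * metric X c z $ m $ n + H2 $ m $ b * metric X c z $ a $ n
        + H3 $ a $ n * metric X c z $ m $ b + H4 $ m $ n * metric X c z $ a $ b)"
    by (rule pseudo_conformally_flatE[OF flatX c zc[OF z]])
  obtain K1 K2 K3 K4 where K: "hermitian_matrix K1" "hermitian_matrix K2" "hermitian_matrix K3" "hermitian_matrix K4"
    and RY: "curvature Y d (F z) = (\<lambda>a b m n. K1 $ a $ b * metric Y d (F z) $ m $ n + K2 $ m $ b * metric Y d (F z) $ a $ n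
        + K3 $ a $ n * metric Y d (F z) $ m $ b + K4 $ m $ n * metric Y d (F z) $ a $ b)"
    by (rule pseudo_conformally_flatE[OF flatY d Fz[OF z]])
  \<comment> \<open>K stems from Y and is pulled back by J, H stems from X. The factor k accompanies
    K because the metric of Y pulls back to k g, and H because the Gauss equation contains k times
    the curvature of X.\<close>
  define A where "A = (\<lambda>K H. (\<chi> a b. complex_of_real k * (herm_form K (J z (axis a 1)) (J z (axis b 1)) - H $ a $ b)) :: complex^'n^'n)"
  have hA: "hermitian_matrix (A K H)" if "hermitian_matrix K" "hermitian_matrix H" for K H
  proof -
    have "A K H $ a $ b = cnj (A K H $ b $ a)" for a b
      using herm_form_cnj[OF that(1), of "J z (axis a 1)" "J z (axis b 1)"] hermitian_matrix_cnj[OF that(2), of b a]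
      by (simp add: A_def)
    then show ?thesis unfolding hermitian_matrix_def by blast
  qed
  define II where "II = (\<lambda>u v. \<Sum>a\<in>UNIV. \<Sum>m\<in>UNIV. (u $ a * v $ m) *s sff z a m)"
  have sff_sym: "sff z a m = sff z m a" for a m
    unfolding sff_def tang_def Jcov_sym[OF z, of "axis a 1" "axis m 1"] ..
  have RYe: "tensor_eval (curvature Y d (F z)) u v w y = herm_form K1 u v * ?h w y
      + herm_form K2 w v * ?h u y + herm_form K3 u y * ?h w v + herm_form K4 w y * ?h u v"
    for u v w y
    unfolding RY by (rule tensor_eval_flat)
  have sff_flat: "?h (sff z a m) (sff z b n) = A K1 H1 $ a $ b * metric X c z $ m $ n + A K2 H2 $ m $ b * metric X c z $ a $ n
        + A K3 H3 $ a $ n * metric X c z $ m $ b + A K4 H4 $ m $ n * metric X c z $ a $ b" for a b m n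
    by (subst gauss_equation[OF z], simp only: RYe RX conf[OF z] herm_form_axis)
      (simp add: A_def algebra_simps)
  have "II u v = 0"
  proof (rule flat_second_fundamental_form_zero[OF dim G(1,2)[OF z] g(1,2)[OF z]
        hA[OF K(1) H(1)] hA[OF K(2) H(2)] hA[OF K(3) H(3)] hA[OF K(4) H(4)] clinear_J[OF z] inj_J[OF z]])
    show "clinear_map (II u)" for u
      unfolding clinear_map_def II_def
      by (auto intro!: linearI simp: vec_eq_iff algebra_simps sum.distrib sum_distrib_left scaleR_sum_right)
    show "II u v = II v u" for u v
      unfolding II_def
      by (subst sum.swap) (intro sum.cong refl arg_cong2[of _ _ _ _ "(*s)"] sff_sym mult.commute)
    show "?h (II u v) (J z w) = 0" for u v w
      by (simp add: II_def herm_form_sum_left herm_form_scale_left sff_orthogonal[OF z])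
    fix u u' v v'
    have "?h (II u u') (II v v') = (\<Sum>a\<in>UNIV. \<Sum>m\<in>UNIV. \<Sum>b\<in>UNIV. \<Sum>n\<in>UNIV.
        ?h (sff z a m) (sff z b n) * (u $ a * cnj (v $ b)) * (u' $ m * cnj (v' $ n)))"
      unfolding II_def herm_form_sum_left herm_form_scale_left
      by (simp add: herm_form_sum_right herm_form_scale_right sum_distrib_left ac_simps)
    also have "\<dots> = tensor_eval (\<lambda>a b m n. ?h (sff z a m) (sff z b n)) u v u' v'"
      unfolding tensor_eval_def by (rule sum.cong[OF refl], rule sum.swap)
    also have "(\<lambda>a b m n. ?h (sff z a m) (sff z b n)) = (\<lambda>a b m n.
        A K1 H1 $ a $ b * metric X c z $ m $ n + A K2 H2 $ m $ b * metric X c z $ a $ n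
        + A K3 H3 $ a $ n * metric X c z $ m $ b + A K4 H4 $ m $ n * metric X c z $ a $ b)"
      by (intro ext sff_flat)
    finally show "?h (II u u') (II v v') = herm_form (A K1 H1) u v * herm_form (metric X c z) u' v'
        + herm_form (A K2 H2) u' v * herm_form (metric X c z) u v'
        + herm_form (A K3 H3) u v' * herm_form (metric X c z) u' v
        + herm_form (A K4 H4) u' v' * herm_form (metric X c z) u v"
      by (simp only: tensor_eval_flat)
  qed
  moreover have "II u v = Jcov z u v - J z (\<Sum>a\<in>UNIV. \<Sum>m\<in>UNIV. (u $ a * v $ m) *s tang z a m)"
  proof -
    have "Jcov z u v = (\<Sum>m\<in>UNIV. v $ m *s Jcov z u (axis m 1))"
      by (rule clinear_map_expand[OF clinear_Jcov[OF z]])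
    also have "\<dots> = (\<Sum>m\<in>UNIV. v $ m *s (\<Sum>a\<in>UNIV. u $ a *s Jcov z (axis a 1) (axis m 1)))"
    proof -
      have "Jcov z u e = (\<Sum>a\<in>UNIV. u $ a *s Jcov z (axis a 1) e)" for e
        unfolding Jcov_sym[OF z, of _ e] by (rule clinear_map_expand[OF clinear_Jcov[OF z]])
      then show ?thesis by simp
    qed
    also have "\<dots> = (\<Sum>a\<in>UNIV. \<Sum>m\<in>UNIV. (u $ a * v $ m) *s Jcov z (axis a 1) (axis m 1))"
      by (subst sum.swap) (simp add: vec.scale_sum_right ac_simps)
    finally have 1: "Jcov z u v = (\<Sum>a\<in>UNIV. \<Sum>m\<in>UNIV. (u $ a * v $ m) *s Jcov z (axis a 1) (axis m 1))" .
    have "linear (J z)" using clinear_J[OF z] by (simp add: clinear_map_def)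
    then have "J z (\<Sum>a\<in>UNIV. \<Sum>m\<in>UNIV. (u $ a * v $ m) *s tang z a m)
        = (\<Sum>a\<in>UNIV. \<Sum>m\<in>UNIV. (u $ a * v $ m) *s J z (tang z a m))"
      by (simp add: linear_sum clinear_map_scale[OF clinear_J[OF z]])
    with 1 show ?thesis
      unfolding II_def sff_def by (simp add: sum_subtractf vec.scale_right_diff_distrib)
  qed
  ultimately show ?thesis by simp
qed

end

section \<open>Tangent spaces of the image\<close>

text \<open>An injective L is bounded below, so the x belonging to t has size O(t) and L (x / t)
  tends to v as the tolerance shrinks; the range of L is closed. The choice of x may depend on t in
  any way.\<close>

lemma vector_derivative_in_range:
  fixes L :: "'a::euclidean_space \<Rightarrow> 'b::euclidean_space" and \<psi> :: "real \<Rightarrow> 'b"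
  assumes L: "linear L" "inj L" and \<psi>: "(\<psi> has_vector_derivative v) (at 0)" "\<psi> 0 = 0"
    and approx: "\<And>e. e > 0 \<Longrightarrow> \<forall>\<^sub>F t in at 0. \<exists>x. norm (\<psi> t - L x) \<le> e * norm x"
  shows "v \<in> range L"
proof -
  obtain B where B: "B > 0" "\<And>x. B * norm x \<le> norm (L x)"
    using linear_inj_bounded_below_pos[OF L] by blast
  have "\<exists>y\<in>range L. dist y v < e" if "e > 0" for e
  proof -
    \<comment> \<open>The 1 accounts for the error of the derivative of \<psi>, the rest for the
      bound on norm x divided by |t|.\<close>
    define C where "C = 1 + 2 / B * (norm v + 1)"
    have C: "C > 0" using B by (auto simp: C_def intro!: add_pos_nonneg)
    \<comment> \<open>\<eta> at most B/2 absorbs the error into the lower bound for L, \<eta> at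
      most 1 bounds norm (\<psi> t) by (norm v + 1) |t|, and the last entry makes \<eta> C smaller
      than e.\<close>
    define \<eta> where "\<eta> = min (B / 2) (min 1 (e / (2 * C)))"
    have \<eta>: "\<eta> > 0" "\<eta> \<le> B / 2" "\<eta> \<le> 1" "\<eta> \<le> e / (2 * C)"
      using B C \<open>e > 0\<close> by (auto simp: \<eta>_def)
    have "\<eta> * C \<le> e / 2" using \<eta>(4) C by (simp add: field_simps)
    then have \<eta>C: "\<eta> * C < e" using \<open>e > 0\<close> by linarith
    have "\<forall>\<^sub>F t in at 0. norm (\<psi> t - t *\<^sub>R v) \<le> \<eta> * \<bar>t\<bar>"
      using \<psi> \<eta>(1) unfolding has_vector_derivative_def has_derivative_within_alt2 by force
    moreover have "\<forall>\<^sub>F t::real in at 0. t \<noteq> 0"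
      by (simp add: eventually_at_filter)
    ultimately have "\<forall>\<^sub>F t in at 0. t \<noteq> 0 \<and> norm (\<psi> t - t *\<^sub>R v) \<le> \<eta> * \<bar>t\<bar> \<and> (\<exists>x. norm (\<psi> t - L x) \<le> \<eta> * norm x)"
      using approx[OF \<eta>(1)] by eventually_elim auto
    then obtain t x where t: "t \<noteq> 0" "norm (\<psi> t - t *\<^sub>R v) \<le> \<eta> * \<bar>t\<bar>" and x: "norm (\<psi> t - L x) \<le> \<eta> * norm x"
      using eventually_happens[of _ "at (0::real)"] by force
    have "norm (\<psi> t) \<le> norm (\<psi> t - t *\<^sub>R v) + norm (t *\<^sub>R v)"
      using norm_triangle_ineq[of "\<psi> t - t *\<^sub>R v" "t *\<^sub>R v"] by simp
    also have "\<dots> \<le> (norm v + 1) * \<bar>t\<bar>"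
      using t(2) mult_right_mono[OF \<eta>(3), of "\<bar>t\<bar>"] by (simp add: algebra_simps)
    finally have psi: "norm (\<psi> t) \<le> (norm v + 1) * \<bar>t\<bar>" .
    have "B * norm x \<le> norm (\<psi> t) + \<eta> * norm x"
      using B(2)[of x] x norm_triangle_sub[of "L x" "\<psi> t"] by (simp add: norm_minus_commute)
    moreover have "\<eta> * norm x \<le> B / 2 * norm x"
      by (intro mult_right_mono \<eta>) simp
    ultimately have "B / 2 * norm x \<le> norm (\<psi> t)" by simp
    with psi have "B / 2 * norm x \<le> (norm v + 1) * \<bar>t\<bar>" by linarith
    then have "norm x \<le> 2 / B * (norm v + 1) * \<bar>t\<bar>"
      using B by (simp add: field_simps)
    then have nx: "\<eta> * norm x \<le> \<eta> * (2 / B * (norm v + 1) * \<bar>t\<bar>)"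
      using \<eta> by (intro mult_left_mono) auto
    have "norm (L x - t *\<^sub>R v) \<le> norm (\<psi> t - t *\<^sub>R v) + norm (\<psi> t - L x)"
      using norm_triangle_ineq4[of "\<psi> t - t *\<^sub>R v" "\<psi> t - L x"] by simp
    also have "\<dots> \<le> \<eta> * C * \<bar>t\<bar>"
      using t(2) x nx by (simp add: C_def algebra_simps)
    also have "\<dots> < e * \<bar>t\<bar>"
      using \<eta>C t(1) by simp
    finally have "norm (L x - t *\<^sub>R v) < e * \<bar>t\<bar>" .
    moreover have "L x - t *\<^sub>R v = t *\<^sub>R (L (x /\<^sub>R t) - v)"
      using t(1) by (simp add: linear_scale[OF L(1)] scaleR_right_diff_distrib)
    ultimately have "norm (L (x /\<^sub>R t) - v) < e"
      using t(1) by (simp add: mult.commute)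
    then show ?thesis by (auto simp: dist_norm)
  qed
  then have "v \<in> closure (range L)" by (simp add: closure_approachable)
  moreover have "closed (range L)"
    by (intro closed_subspace linear_subspace_image L(1) subspace_UNIV)
  ultimately show ?thesis by simp
qed

lemma clinear_map_norm_diff_le:
  assumes "clinear_map L" "clinear_map L'"
  shows "norm (L x - L' x) \<le> norm x * (\<Sum>a\<in>UNIV. norm (L (axis a 1) - L' (axis a 1)))"
proof -
  have sc: "norm (c *s (w::complex^'b)) = norm c * norm w" for c w
    by (simp add: norm_vec_def norm_mult L2_set_right_distrib)
  have "L x - L' x = (\<Sum>a\<in>UNIV. x $ a *s (L (axis a 1) - L' (axis a 1)))"
    unfolding clinear_map_expand[OF assms(1), of x] clinear_map_expand[OF assms(2), of x]
    by (simp add: sum_subtractf vec.scale_right_diff_distrib)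
  also have "norm \<dots> \<le> (\<Sum>a\<in>UNIV. norm (x $ a) * norm (L (axis a 1) - L' (axis a 1)))"
    by (rule order_trans[OF norm_sum], intro sum_mono) (simp only: sc order_refl)
  also have "\<dots> \<le> (\<Sum>a\<in>UNIV. norm x * norm (L (axis a 1) - L' (axis a 1)))"
    by (intro sum_mono mult_right_mono Finite_Cartesian_Product.norm_nth_le norm_ge_zero)
  finally show ?thesis by (simp add: sum_distrib_left)
qed

section \<open>Tangential fields and velocities along the image\<close>

context conformal_local_map
begin

text \<open>Complex linearity reduces the estimate to the finitely many basis vectors, so pointwise
  continuity becomes a bound uniform in u.\<close>

lemma J_uniformly_close:
  assumes z: "z \<in> S" and "e > 0"
  shows "\<forall>\<^sub>F x in nhds z. \<forall>u. norm (J x u - J z u) \<le> e * norm u"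
proof -
  have "((\<lambda>x. J x (axis a 1)) \<longlongrightarrow> J z (axis a 1)) (nhds z)" for a
    using has_derivative_continuous[OF J_has_derivative[OF z], of "axis a 1"]
      tendsto_at_iff_tendsto_nhds[of "\<lambda>x. J x (axis a 1)" z] by (simp add: isCont_def)
  then have "((\<lambda>x. \<Sum>a\<in>UNIV. norm (J x (axis a 1) - J z (axis a 1))) \<longlongrightarrow> (\<Sum>a\<in>UNIV. norm (J z (axis a 1) - J z (axis a 1)))) (nhds z)"
    by (intro tendsto_intros)
  then have "\<forall>\<^sub>F x in nhds z. (\<Sum>a\<in>UNIV. norm (J x (axis a 1) - J z (axis a 1))) < e"
    using \<open>e > 0\<close> by (intro order_tendstoD(2)) simp_all
  moreover have "\<forall>\<^sub>F x in nhds z. x \<in> S"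
    using S(1) z by (rule eventually_nhds_in_open)
  ultimately show ?thesis
  proof eventually_elim
    case (elim x)
    show ?case
    proof
      fix u
      have "norm (J x u - J z u) \<le> norm u * (\<Sum>a\<in>UNIV. norm (J x (axis a 1) - J z (axis a 1)))"
        by (rule clinear_map_norm_diff_le[OF clinear_J[OF elim(2)] clinear_J[OF z]])
      also have "\<dots> \<le> norm u * e"
        using elim(1) by (intro mult_left_mono) auto
      finally show "norm (J x u - J z u) \<le> e * norm u" by (simp add: mult.commute)
    qed
  qed
qed

lemma line_tendsto: "((\<lambda>t::real. z + t *\<^sub>R u) \<longlongrightarrow> (z::complex^'n)) (at 0)"
  by (rule tendsto_eq_intros refl | simp)+

lemma line_has_vector_derivative: "((\<lambda>t. z + t *\<^sub>R u) has_vector_derivative (u::complex^'n)) (at t)"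
  by (auto intro!: derivative_eq_intros)

text \<open>Differentiating \<open>W \<circ> F = J w\<close> without assuming that \<open>w\<close> is differentiable: the error of
  freezing \<open>w\<close> at \<open>z\<close> is \<open>J x\<close>-tangential, hence infinitesimally \<open>J z\<close>-tangential.\<close>

lemma covariant_deriv_tangential:
  assumes z: "z \<in> S" and W: "smooth_on Q W" "open Q" "F z \<in> Q"
    and tan: "\<And>x. x \<in> S \<Longrightarrow> F x \<in> Q \<Longrightarrow> W (F x) \<in> range (J x)"
    and II: "\<And>u v. Jcov z u v \<in> range (J z)"
  shows "covariant_deriv Y d (J z u) W (F z) \<in> range (J z)"
proof -
  obtain w where w: "W (F z) = J z w" using tan[OF z W(3)] by blast
  define D where "D = frechet_derivative W (at (F z))"
  define \<psi> where "\<psi> = (\<lambda>t::real. W (F (z + t *\<^sub>R u)) - J (z + t *\<^sub>R u) w)"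
  have "((\<lambda>x. W (F x) - J x w) has_derivative (\<lambda>h. D (J z h) - J' z w h)) (at z)"
    unfolding D_def
    by (intro has_derivative_diff has_derivative_compose[OF F_has_derivative[OF z] smooth_on_has_derivative[OF W(1,3)]]
        J_has_derivative z)
  then have "((\<lambda>x. W (F x) - J x w) has_derivative (\<lambda>h. D (J z h) - J' z w h)) (at (z + 0 *\<^sub>R u))" by simp
  from has_derivative_compose[OF line_has_vector_derivative[of z u 0, unfolded has_vector_derivative_def] this]
  have "(\<psi> has_derivative (\<lambda>t. D (J z (t *\<^sub>R u)) - J' z w (t *\<^sub>R u))) (at 0)"
    unfolding \<psi>_def by simp
  moreover have "linear D" "linear (J z)" "linear (J' z w)"
    using has_derivative_linear[OF smooth_on_has_derivative[OF W(1,3)]] clinear_J[OF z] clinear_J'[OF z]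
    by (auto simp: D_def clinear_map_def)
  ultimately have psi: "(\<psi> has_vector_derivative (D (J z u) - J' z w u)) (at 0)"
    unfolding has_vector_derivative_def by (simp add: linear_scale scaleR_right_diff_distrib)
  have "D (J z u) - J' z w u \<in> range (J z)"
  proof (rule vector_derivative_in_range[OF _ inj_J[OF z] psi])
    show "linear (J z)" by fact
    show "\<psi> 0 = 0" by (simp add: \<psi>_def w)
    fix e :: real assume "e > 0"
    have "\<forall>\<^sub>F x in nhds z. F x \<in> Q"
    proof -
      have "(F \<longlongrightarrow> F z) (nhds z)"
        using has_derivative_continuous[OF F_has_derivative[OF z]]
        by (simp add: continuous_within tendsto_at_iff_tendsto_nhds)
      then show ?thesis using W(2,3) by (rule topological_tendstoD)
    qed
    moreover have "\<forall>\<^sub>F x in nhds z. x \<in> S"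
      using S(1) z by (rule eventually_nhds_in_open)
    ultimately have "\<forall>\<^sub>F x in nhds z. \<exists>y. norm (W (F x) - J x w - J z y) \<le> e * norm y"
      using J_uniformly_close[OF z \<open>e > 0\<close>]
    proof eventually_elim
      case (elim x)
      obtain y where y: "W (F x) = J x y" using tan elim by blast
      \<comment> \<open>The vector y - w is the approximant; what remains is J x - J z applied to
        it.\<close>
      have "W (F x) - J x w - J z (y - w) = J x (y - w) - J z (y - w)"
        unfolding y by (simp add: clinear_map_diff[OF clinear_J[OF elim(2)]])
      then show ?case using elim(3) by metis
    qed
    from eventually_compose_filterlim[OF this line_tendsto[of z u]]
    show "\<forall>\<^sub>F t in at 0. \<exists>x. norm (\<psi> t - J z x) \<le> e * norm x"
      unfolding \<psi>_def .
  qed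
  then obtain y where "D (J z u) - J' z w u = J z y" by blast
  then have D: "D (J z u) = J z y + J' z w u" by (simp add: algebra_simps)
  \<comment> \<open>The Christoffel term of the covariant derivative completes
    \<open>J' z w u\<close> to \<open>Jcov z w u\<close>, which is tangential by assumption.\<close>
  obtain y' where y': "Jcov z w u = J z y'" using II by blast
  have "covariant_deriv Y d (J z u) W (F z) = D (J z u) + christoffel_vec Y d (F z) (J z u) (W (F z))"
    unfolding covariant_deriv_def christoffel_vec_def D_def ..
  also have "\<dots> = J z (y + y')"
    unfolding D w using y' by (simp add: Jcov_def clinear_map_add[OF clinear_J[OF z]])
  finally show ?thesis by blast
qed

text \<open>The hypothesis on curves replaces continuity of \<open>F\<^sup>-\<^sup>1 \<circ> G\<close>.\<close>

lemma velocity_in_range: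
  assumes z: "z \<in> S" and G: "(G has_vector_derivative v) (at 0)" "G 0 = F z"
    and lift: "\<And>N. open N \<Longrightarrow> z \<in> N \<Longrightarrow> N \<subseteq> S \<Longrightarrow> \<forall>\<^sub>F t in at 0. G t \<in> F ` N"
  shows "v \<in> range (J z)"
proof (rule vector_derivative_in_range[OF _ inj_J[OF z]])
  show "linear (J z)" using clinear_J[OF z] by (simp add: clinear_map_def)
  show "((\<lambda>t. G t - F z) has_vector_derivative v) (at 0)"
    using has_vector_derivative_diff[OF G(1) has_vector_derivative_const[of "F z"]] by simp
  show "G 0 - F z = 0" using G(2) by simp
  fix e :: real assume "e > 0"
  \<comment> \<open>The increment x - z of a nearby lift is the approximant, and differentiability
    of F bounds its error.\<close>
  obtain \<delta> where \<delta>: "\<delta> > 0" "\<And>x. norm (x - z) < \<delta> \<Longrightarrow> norm (F x - F z - J z (x - z)) \<le> e * norm (x - z)"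
    using F_has_derivative[OF z] \<open>e > 0\<close> unfolding has_derivative_at_alt by blast
  have "\<forall>\<^sub>F t in at 0. G t \<in> F ` (ball z \<delta> \<inter> S)"
    using \<delta>(1) z S(1) by (intro lift) auto
  then show "\<forall>\<^sub>F t in at 0. \<exists>x. norm (G t - F z - J z x) \<le> e * norm x"
  proof eventually_elim
    case (elim t)
    then obtain x where "G t = F x" "norm (x - z) < \<delta>"
      by (auto simp: dist_norm norm_minus_commute)
    with \<delta>(2)[of x] show ?case by auto
  qed
qed

end

section \<open>Charts of the maximal atlas as homeomorphisms\<close>

lemma
  assumes c: "c \<in> holo_charts M"
  shows chart_dom_subset: "chart_dom c \<subseteq> topspace (space_top M)"
    and openin_chart_dom: "openin (space_top M) (chart_dom c)"
    and homeomorphic_maps_chart: "homeomorphic_maps (subtopology (space_top M) (chart_dom c))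
      (top_of_set (chart_img c)) (chart_map c) (chart_inv c)"
proof -
  have 1: "openin (space_top M) (chart_dom c)"
    and h: "homeomorphic_map (subtopology (space_top M) (chart_dom c)) (top_of_set (chart_img c)) (chart_map c)"
    using c by (auto simp: holo_charts_def is_chart_def)
  show "openin (space_top M) (chart_dom c)" by (rule 1)
  show sub: "chart_dom c \<subseteq> topspace (space_top M)" using 1 by (rule openin_subset)
  have top: "topspace (subtopology (space_top M) (chart_dom c)) = chart_dom c"
    using sub by auto
  have inj: "inj_on (chart_map c) (chart_dom c)"
    using h top by (simp add: homeomorphic_map_def)
  obtain g where g: "homeomorphic_maps (subtopology (space_top M) (chart_dom c)) (top_of_set (chart_img c)) (chart_map c) g"
    using h unfolding homeomorphic_map_maps by blast
  have "g y = chart_inv c y" if y: "y \<in> chart_img c" for y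
  proof -
    obtain x where x: "x \<in> chart_dom c" "y = chart_map c x" using y unfolding chart_img_def by blast
    then have "g y = x" using g top by (auto simp: homeomorphic_maps_def)
    then show ?thesis using x inj by (simp add: chart_inv_def inv_into_f_f)
  qed
  then show "homeomorphic_maps (subtopology (space_top M) (chart_dom c)) (top_of_set (chart_img c)) (chart_map c) (chart_inv c)"
    using homeomorphic_maps_eq[OF g] by simp
qed

lemma
  assumes c: "c \<in> holo_charts M"
  shows chart_inv_map: "p \<in> chart_dom c \<Longrightarrow> chart_inv c (chart_map c p) = p"
    and chart_map_inv: "z \<in> chart_img c \<Longrightarrow> chart_map c (chart_inv c z) = z"
    and chart_inv_in_dom: "z \<in> chart_img c \<Longrightarrow> chart_inv c z \<in> chart_dom c"
    and chart_map_in_img: "p \<in> chart_dom c \<Longrightarrow> chart_map c p \<in> chart_img c"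
  using homeomorphic_maps_chart[OF c] chart_dom_subset[OF c]
  by (auto simp: homeomorphic_maps_def continuous_map_def Pi_iff)

lemma open_chart_image:
  assumes c: "c \<in> holo_charts M" and U: "openin (space_top M) U"
  shows "open (chart_map c ` (chart_dom c \<inter> U))"
proof -
  have "open_map (subtopology (space_top M) (chart_dom c)) (top_of_set (chart_img c)) (chart_map c)"
    using homeomorphic_maps_chart[OF c] homeomorphic_imp_open_map homeomorphic_maps_imp_map by blast
  moreover have "openin (subtopology (space_top M) (chart_dom c)) (chart_dom c \<inter> U)"
    by (rule openin_subtopology_Int2[OF U])
  ultimately have "openin (top_of_set (chart_img c)) (chart_map c ` (chart_dom c \<inter> U))"
    by (simp add: open_map_def)
  moreover have "open (chart_img c)" using c by (simp add: holo_charts_def is_chart_def)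
  ultimately show ?thesis using openin_open_eq by blast
qed

lemma openin_chart_inv_image:
  assumes c: "c \<in> holo_charts M" and N: "open N" "N \<subseteq> chart_img c"
  shows "openin (space_top M) (chart_inv c ` N)"
proof -
  have "open_map (top_of_set (chart_img c)) (subtopology (space_top M) (chart_dom c)) (chart_inv c)"
    using homeomorphic_maps_chart[OF c] homeomorphic_imp_open_map homeomorphic_maps_imp_map homeomorphic_maps_sym by blast
  moreover have "openin (top_of_set (chart_img c)) N"
    using N by (simp add: openin_open_eq openin_subtopology) blast
  ultimately have "openin (subtopology (space_top M) (chart_dom c)) (chart_inv c ` N)"
    by (simp add: open_map_def)
  then show ?thesis
    using openin_chart_dom[OF c] openin_trans_full by blast
qed

lemma holo_chart_exists:
  assumes "complex_manifold M" "p \<in> topspace (space_top M)"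
  obtains c where "c \<in> holo_charts M" "p \<in> chart_dom c"
proof -
  have "atlas M \<subseteq> holo_charts M"
    using assms(1) by (auto simp: complex_manifold_def complex_atlas_def holo_charts_def)
  moreover have "p \<in> (\<Union>c\<in>atlas M. chart_dom c)"
    using assms by (simp add: complex_manifold_def complex_atlas_def)
  ultimately show ?thesis using that by blast
qed

text \<open>Identifies the parameter domains in \<open>complex_submanifold\<close> with those in
  \<open>holomorphic_map\<close>.\<close>

lemma chart_map_vimage:
  assumes "c \<in> holo_charts M"
  shows "chart_map c ` (chart_dom c \<inter> P) = chart_img c \<inter> chart_inv c -` P"
proof (intro equalityI subsetI)
  fix z assume "z \<in> chart_map c ` (chart_dom c \<inter> P)"
  then show "z \<in> chart_img c \<inter> chart_inv c -` P"
    using chart_inv_map[OF assms] chart_map_in_img[OF assms] by auto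
next
  fix z assume z: "z \<in> chart_img c \<inter> chart_inv c -` P"
  then have "z = chart_map c (chart_inv c z)" "chart_inv c z \<in> chart_dom c \<inter> P"
    using chart_map_inv[OF assms] chart_inv_in_dom[OF assms] by auto
  then show "z \<in> chart_map c ` (chart_dom c \<inter> P)" by blast
qed

section \<open>From coordinates to the embedded image\<close>

locale conformal_embedding =
  fixes X :: "('a, 'n::finite) hermitian_structure" and Y :: "('b, 'm::finite) hermitian_structure"
    and f :: "'a \<Rightarrow> 'b"
  assumes X: "hermitian_manifold X" and Y: "kaehler_manifold Y"
    and emb: "holomorphic_embedding X Y f" and conf: "conformal_map X Y f"
begin

definition coord_dom :: "('a, 'n) chart \<Rightarrow> ('b, 'm) chart \<Rightarrow> (complex^'n) set" where
  "coord_dom c d = chart_map c ` (chart_dom c \<inter> f -` chart_dom d)"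

abbreviation fX :: "'b set" where
  "fX \<equiv> f ` topspace (space_top X)"

lemma continuous_f: "continuous_map (space_top X) (space_top Y) f"
  and holo_f: "c \<in> holo_charts X \<Longrightarrow> d \<in> holo_charts Y \<Longrightarrow> holo_on (coord_dom c d) (local_rep c d f)"
  and homeo_f: "homeomorphic_map (space_top X) (subtopology (space_top Y) fX) f"
  using emb by (auto simp: holomorphic_embedding_def holomorphic_map_def embedding_map_def coord_dom_def)

lemma open_coord_dom:
  assumes "c \<in> holo_charts X" "d \<in> holo_charts Y"
  shows "open (coord_dom c d)"
proof -
  have "openin (space_top X) {x \<in> topspace (space_top X). f x \<in> chart_dom d}"
    by (rule openin_continuous_map_preimage[OF continuous_f openin_chart_dom[OF assms(2)]])
  \<comment> \<open>The plain preimage may contain points outside the space; intersecting with the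
    chart domain removes them.\<close>
  moreover have "chart_dom c \<inter> {x \<in> topspace (space_top X). f x \<in> chart_dom d} = chart_dom c \<inter> f -` chart_dom d"
    using chart_dom_subset[OF assms(1)] by blast
  ultimately show ?thesis
    using open_chart_image[OF assms(1)] unfolding coord_dom_def by metis
qed

lemma local_rep_map: "c \<in> holo_charts X \<Longrightarrow> x \<in> chart_dom c \<Longrightarrow> local_rep c d f (chart_map c x) = chart_map d (f x)"
  by (simp add: local_rep_def chart_inv_map)

lemma conformal_factor:
  "\<exists>k. \<forall>c\<in>holo_charts X. \<forall>d\<in>holo_charts Y.
    conformal_local_map X Y c d (coord_dom c d) (local_rep c d f) k"
proof -
  obtain k where k0: "k > 0" and k: "\<forall>c\<in>holo_charts X. \<forall>d\<in>holo_charts Y. \<forall>p\<in>chart_dom c \<inter> f -` chart_dom d. \<forall>u v.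
       herm_form (metric Y d (chart_map d (f p))) (frechet_derivative (local_rep c d f) (at (chart_map c p)) u)
         (frechet_derivative (local_rep c d f) (at (chart_map c p)) v)
        = complex_of_real k * herm_form (metric X c (chart_map c p)) u v"
    using conf unfolding conformal_map_def Let_def by (elim exE conjE) (rule that)
  have "conformal_local_map X Y c d (coord_dom c d) (local_rep c d f) k"
    if c: "c \<in> holo_charts X" and d: "d \<in> holo_charts Y" for c d
  proof
    show "coord_dom c d \<subseteq> chart_img c"
      using chart_map_in_img[OF c] by (auto simp: coord_dom_def)
    show "local_rep c d f ` coord_dom c d \<subseteq> chart_img d"
      using chart_map_in_img[OF d] local_rep_map[OF c, of _ d] by (auto simp: coord_dom_def)
    show "herm_form (metric Y d (local_rep c d f z)) (frechet_derivative (local_rep c d f) (at z) u)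
         (frechet_derivative (local_rep c d f) (at z) v) = complex_of_real k * herm_form (metric X c z) u v"
      if "z \<in> coord_dom c d" for z u v
    proof -
      obtain p where p: "p \<in> chart_dom c \<inter> f -` chart_dom d" "z = chart_map c p"
        using \<open>z \<in> coord_dom c d\<close> unfolding coord_dom_def by blast
      then show ?thesis using k[rule_format, OF c d p(1)] local_rep_map[OF c, of p d] by simp
    qed
  qed (use X Y c d k0 open_coord_dom[OF c d] holo_f[OF c d] in simp_all)
  then show ?thesis by blast
qed


text \<open>Images of coordinate lines realise every vector of the range. Conversely, a curve in the
  image is handled by \<open>velocity_in_range\<close>, whose lifting hypothesis comes from the
  embedding property.\<close>

lemma tangent_vecs_image:
  assumes c: "c \<in> holo_charts X" and d: "d \<in> holo_charts Y" and x: "x \<in> chart_dom c" "f x \<in> chart_dom d"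
  shows "tangent_vecs d fX (f x) = range (frechet_derivative (local_rep c d f) (at (chart_map c x)))"
proof -
  obtain k where "conformal_local_map X Y c d (coord_dom c d) (local_rep c d f) k"
    using conformal_factor c d by blast
  then interpret conformal_local_map X Y c d "coord_dom c d" "local_rep c d f" k .
  let ?F = "local_rep c d f" and ?z = "chart_map c x"
  have z: "?z \<in> coord_dom c d" using x by (auto simp: coord_dom_def)
  have Fz: "?F ?z = chart_map d (f x)" by (rule local_rep_map[OF c x(1)])
  have "tangent_vecs d fX (f x) = range (J ?z)"
  proof (intro equalityI subsetI)
    fix v assume "v \<in> range (J ?z)"
    then obtain u where u: "v = J ?z u" by blast
    define \<gamma> where "\<gamma> = (\<lambda>t::real. f (chart_inv c (?z + t *\<^sub>R u)))"
    have "\<forall>\<^sub>F t in nhds 0. ?z + t *\<^sub>R u \<in> coord_dom c d"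
    proof -
      have "((\<lambda>t. ?z + t *\<^sub>R u) \<longlongrightarrow> ?z + 0 *\<^sub>R u) (nhds 0)"
        by (intro tendsto_intros filterlim_ident)
      then show ?thesis
        using S(1) z by (intro topological_tendstoD) auto
    qed
    then obtain \<epsilon> where e: "\<epsilon> > 0" "\<And>t. \<bar>t\<bar> < \<epsilon> \<Longrightarrow> ?z + t *\<^sub>R u \<in> coord_dom c d"
      unfolding eventually_nhds_metric by (auto simp: dist_real_def)
    have g: "\<gamma> t \<in> fX \<inter> chart_dom d" if t: "\<bar>t\<bar> < \<epsilon>" for t
    proof -
      obtain p where "p \<in> chart_dom c" "f p \<in> chart_dom d" "?z + t *\<^sub>R u = chart_map c p"
        using e(2)[OF t] unfolding coord_dom_def by blast
      then show ?thesis using chart_inv_map[OF c] chart_dom_subset[OF c] by (auto simp: \<gamma>_def)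
    qed
    have "(?F has_derivative J ?z) (at (?z + 0 *\<^sub>R u))"
      using F_has_derivative[OF z] by simp
    from has_derivative_compose[OF line_has_vector_derivative[of ?z u 0, unfolded has_vector_derivative_def] this]
    have "((chart_map d \<circ> \<gamma>) has_vector_derivative v) (at 0)"
      using clinear_J[OF z] unfolding has_vector_derivative_def
      by (simp add: u clinear_map_def linear_scale \<gamma>_def local_rep_def o_def)
    moreover have "\<gamma> 0 = f x" by (simp add: \<gamma>_def chart_inv_map[OF c x(1)])
    ultimately show "v \<in> tangent_vecs d fX (f x)"
      unfolding tangent_vecs_def using e(1) g by blast
  next
    fix v assume "v \<in> tangent_vecs d fX (f x)"
    then obtain \<gamma> \<epsilon> where \<gamma>: "\<epsilon> > 0" "\<gamma> (0::real) = f x" "\<And>t. \<bar>t\<bar> < \<epsilon> \<Longrightarrow> \<gamma> t \<in> fX \<inter> chart_dom d"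
      "((chart_map d \<circ> \<gamma>) has_vector_derivative v) (at 0)"
      unfolding tangent_vecs_def by blast
    show "v \<in> range (J ?z)"
    proof (rule velocity_in_range[OF z \<gamma>(4)])
      show "(chart_map d \<circ> \<gamma>) 0 = ?F ?z" using \<gamma>(2) Fz by simp
      fix N assume N: "open N" "?z \<in> N" "N \<subseteq> coord_dom c d"
      have Nc: "N \<subseteq> chart_img c" using N(3) S(2) by blast
      let ?N = "chart_inv c ` N"
      \<comment> \<open>Relative openness forces points of the image near f x to come from points
        near x, so the curve cannot approach f x along another sheet.\<close>
      have "openin (subtopology (space_top Y) fX) (f ` ?N)"
        using homeomorphic_imp_open_map[OF homeo_f] openin_chart_inv_image[OF c N(1) Nc] by (simp add: open_map_def)
      then obtain V where V: "openin (space_top Y) V" "f ` ?N = V \<inter> fX"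
        unfolding openin_subtopology by blast
      have "x \<in> ?N" using N(2) chart_inv_map[OF c x(1)] by force
      then have fxV: "f x \<in> V" using V(2) by blast
      have "open (chart_map d ` (chart_dom d \<inter> V))" by (rule open_chart_image[OF d V(1)])
      moreover have "((chart_map d \<circ> \<gamma>) \<longlongrightarrow> (chart_map d \<circ> \<gamma>) 0) (at 0)"
        using has_vector_derivative_continuous[OF \<gamma>(4)] by (simp add: isCont_def)
      moreover have "(chart_map d \<circ> \<gamma>) 0 \<in> chart_map d ` (chart_dom d \<inter> V)"
        using fxV x(2) \<gamma>(2) by simp
      ultimately have "\<forall>\<^sub>F t in at 0. (chart_map d \<circ> \<gamma>) t \<in> chart_map d ` (chart_dom d \<inter> V)"
        using topological_tendstoD by blast
      moreover have "\<forall>\<^sub>F t in at 0. \<bar>t\<bar> < \<epsilon>"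
        using \<gamma>(1) by (auto simp: eventually_at dist_real_def)
      ultimately show "\<forall>\<^sub>F t in at 0. (chart_map d \<circ> \<gamma>) t \<in> ?F ` N"
      proof eventually_elim
        case (elim t)
        obtain q where q: "q \<in> chart_dom d" "q \<in> V" "chart_map d (\<gamma> t) = chart_map d q"
          using elim(1) by auto
        have t: "\<gamma> t \<in> fX" "\<gamma> t \<in> chart_dom d" using \<gamma>(3)[OF elim(2)] by auto
        then have "\<gamma> t = q" using q(1,3) chart_inv_map[OF d] by metis
        then have "\<gamma> t \<in> f ` ?N" using q(2) t(1) V(2) by blast
        then obtain y where "y \<in> N" "\<gamma> t = f (chart_inv c y)" by blast
        then show ?case by (auto simp: local_rep_def)
      qed
    qed
  qed
  then show ?thesis by (simp add: J_def)
qed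

text \<open>f after an inverse chart is the parametrisation; since f is a homeomorphism onto its
  image, an open V of Y cuts f (chart_dom c) out of that image.\<close>

lemma complex_submanifold_image: "complex_submanifold TYPE('n) Y fX"
  unfolding complex_submanifold_def
proof (intro conjI ballI)
  show "fX \<subseteq> topspace (space_top Y)"
    using continuous_map_image_subset_topspace[OF continuous_f] .
  fix p assume "p \<in> fX"
  then obtain x where x: "x \<in> topspace (space_top X)" "p = f x" by blast
  have "complex_manifold X" using X by (simp add: hermitian_manifold_def)
  then obtain c where c: "c \<in> holo_charts X" "x \<in> chart_dom c"
    by (rule holo_chart_exists[OF _ x(1)])
  have "openin (subtopology (space_top Y) fX) (f ` chart_dom c)"
    using homeomorphic_imp_open_map[OF homeo_f] openin_chart_dom[OF c(1)] by (simp add: open_map_def)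
  then obtain V where V: "openin (space_top Y) V" "f ` chart_dom c = V \<inter> fX"
    unfolding openin_subtopology by blast
  have h1: "homeomorphic_map (top_of_set (chart_img c)) (subtopology (space_top X) (chart_dom c)) (chart_inv c)"
    using homeomorphic_maps_chart[OF c(1)] homeomorphic_maps_imp_map homeomorphic_maps_sym by blast
  have "homeomorphic_map (subtopology (space_top X) (chart_dom c)) (subtopology (subtopology (space_top Y) fX) V) f"
  proof (rule homeomorphic_map_subtopologies[OF homeo_f])
    have "topspace (space_top X) \<inter> chart_dom c = chart_dom c"
      using chart_dom_subset[OF c(1)] by blast
    then show "f ` (topspace (space_top X) \<inter> chart_dom c) = topspace (subtopology (space_top Y) fX) \<inter> V"
      using V openin_subset[OF V(1)] by auto
  qed
  from homeomorphic_map_compose[OF h1 this]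
  have h: "homeomorphic_map (top_of_set (chart_img c)) (subtopology (space_top Y) (fX \<inter> V)) (f \<circ> chart_inv c)"
    by (simp add: subtopology_subtopology)
  have dom: "chart_img c \<inter> (f \<circ> chart_inv c) -` chart_dom d = coord_dom c d" for d
    unfolding coord_dom_def chart_map_vimage[OF c(1)] by auto
  have rep: "chart_map d \<circ> (f \<circ> chart_inv c) = local_rep c d f" for d
    by (simp add: local_rep_def comp_assoc)
  have inj: "inj (frechet_derivative (local_rep c d f) (at w))" if "d \<in> holo_charts Y" "w \<in> coord_dom c d" for d w
    using emb c(1) that unfolding holomorphic_embedding_def coord_dom_def by blast
  show "\<exists>V (W :: (complex^'n) set) h. openin (space_top Y) V \<and> p \<in> V \<and> open W \<and>
        homeomorphic_map (top_of_set W) (subtopology (space_top Y) (fX \<inter> V)) h \<and>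
        (\<forall>d\<in>holo_charts Y. holo_on (W \<inter> h -` chart_dom d) (chart_map d \<circ> h) \<and>
           (\<forall>w\<in>W \<inter> h -` chart_dom d. inj (frechet_derivative (chart_map d \<circ> h) (at w))))"
  proof (intro exI[of _ V] exI[of _ "chart_img c"] exI[of _ "f \<circ> chart_inv c"] conjI ballI)
    show "openin (space_top Y) V" by (rule V(1))
    show "p \<in> V" using V(2) c(2) x(2) by blast
    show "open (chart_img c)" by (rule hermitian_chart(1)[OF X c(1)])
    show "homeomorphic_map (top_of_set (chart_img c)) (subtopology (space_top Y) (fX \<inter> V)) (f \<circ> chart_inv c)"
      by (rule h)
    fix d assume d: "d \<in> holo_charts Y"
    show "holo_on (chart_img c \<inter> (f \<circ> chart_inv c) -` chart_dom d) (chart_map d \<circ> (f \<circ> chart_inv c))"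
      unfolding dom rep by (rule holo_f[OF c(1) d])
    fix w assume "w \<in> chart_img c \<inter> (f \<circ> chart_inv c) -` chart_dom d"
    then show "inj (frechet_derivative (chart_map d \<circ> (f \<circ> chart_inv c)) (at w))"
      unfolding dom rep by (rule inj[OF d])
  qed
qed

text \<open>By \<open>tangent_vecs_image\<close> the tangent space is the range of J, so
  tangentiality of the covariant derivative makes it orthogonal to every normal vector.\<close>

lemma totally_geodesic_image:
  assumes dim: "CARD('m) < 2 * CARD('n)"
    and flatX: "pseudo_conformally_flat X (curvature X)" and flatY: "pseudo_conformally_flat Y (curvature Y)"
  shows "totally_geodesic Y fX"
  unfolding totally_geodesic_def
proof (intro ballI allI impI)
  fix d p Q W v \<eta>
  assume d: "d \<in> holo_charts Y" and p: "p \<in> fX \<inter> chart_dom d"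
    and W: "open Q \<and> chart_map d p \<in> Q \<and> Q \<subseteq> chart_img d \<and> smooth_on Q W \<and>
     (\<forall>q\<in>fX \<inter> chart_dom d. chart_map d q \<in> Q \<longrightarrow> W (chart_map d q) \<in> tangent_vecs d fX q)"
    and v: "v \<in> tangent_vecs d fX p" and \<eta>: "\<eta> \<in> normal_vecs Y d fX p"
  obtain x where x: "x \<in> topspace (space_top X)" "p = f x" using p by blast
  have "complex_manifold X" using X by (simp add: hermitian_manifold_def)
  then obtain c where cx: "c \<in> holo_charts X" "x \<in> chart_dom c"
    by (rule holo_chart_exists[OF _ x(1)])
  obtain k where "conformal_local_map X Y c d (coord_dom c d) (local_rep c d f) k"
    using conformal_factor cx(1) d by blast
  then interpret conformal_local_map X Y c d "coord_dom c d" "local_rep c d f" k .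
  let ?z = "chart_map c x"
  have z: "?z \<in> coord_dom c d" using cx(2) x p by (auto simp: coord_dom_def)
  have Fz: "local_rep c d f ?z = chart_map d p" using local_rep_map[OF cx, of d] x(2) by simp
  have T: "tangent_vecs d fX p = range (J ?z)"
    using tangent_vecs_image[OF cx(1) d cx(2)] p x(2) by (simp add: J_def)
  obtain u where u: "v = J ?z u" using v T by blast
  have "covariant_deriv Y d (J ?z u) W (local_rep c d f ?z) \<in> range (J ?z)"
  proof (rule covariant_deriv_tangential[OF z])
    show "smooth_on Q W" "open Q" "local_rep c d f ?z \<in> Q" using W Fz by simp_all
    show "W (local_rep c d f y) \<in> range (J y)" if y: "y \<in> coord_dom c d" "local_rep c d f y \<in> Q" for y
    proof -
      obtain q where q: "q \<in> chart_dom c" "f q \<in> chart_dom d" "y = chart_map c q"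
        using y(1) by (auto simp: coord_dom_def)
      then have "W (chart_map d (f q)) \<in> tangent_vecs d fX (f q)"
        using W y(2) local_rep_map[OF cx(1) q(1), of d] chart_dom_subset[OF cx(1)] by auto
      then show ?thesis
        using tangent_vecs_image[OF cx(1) d q(1,2)] local_rep_map[OF cx(1) q(1), of d] q(3) by (simp add: J_def)
    qed
    show "Jcov ?z u v \<in> range (J ?z)" for u v
      by (rule Jcov_tangential[OF z dim flatX flatY])
  qed
  then have "covariant_deriv Y d v W (chart_map d p) \<in> tangent_vecs d fX p"
    unfolding T u Fz .
  then show "Re (herm_form (metric Y d (chart_map d p)) (covariant_deriv Y d v W (chart_map d p)) \<eta>) = 0"
    using \<eta> unfolding normal_vecs_def by blast
qed

end

theorem theorem1p3:
  fixes X :: "('a, 'n::finite) hermitian_structure"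
    and Y :: "('b, 'm::finite) hermitian_structure"
    and f :: "'a \<Rightarrow> 'b"
  assumes "kaehler_manifold X" and "kaehler_manifold Y"
    and "2 \<le> CARD('n)" and "CARD('n) \<le> CARD('m)" and "CARD('m) \<le> 2 * CARD('n) - 1"
    and "holomorphic_embedding X Y f" and "conformal_map X Y f"
    and "pseudo_conformally_flat X (curvature X)"
    and "pseudo_conformally_flat Y (curvature Y)"
  shows "totally_geodesic_submanifold TYPE('n) Y (f ` topspace (space_top X))"
proof -
  interpret conformal_embedding X Y f
    using assms by unfold_locales (simp_all add: kaehler_manifold_def)
  \<comment> \<open>The subtraction on naturals does not truncate as \<open>CARD('n)\<close> is at
    least 2, so the bound on \<open>CARD('m)\<close> is the strict inequality used above.\<close>
  show ?thesis
    unfolding totally_geodesic_submanifold_def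
    using complex_submanifold_image totally_geodesic_image assms by simp
qed

end
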